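(* Let $K\subset\mathbb{R}^2$ be a convex body whose Steiner point is the origin $o$. For $\lambda>0$ let $\mathcal{P}_\lambda$ be a homogeneous Poisson point process of intensity $\lambda$ in $\mathbb{R}^2$, let $\mathscr{S}_\lambda$ be the event that some cell of the Voronoi tessellation generated by $\mathcal{P}_\lambda$ contains $K$, and on $\mathscr{S}_\lambda$ let $Z_\lambda$ be the nucleus of the cell containing $K$. Then, conditionally on $\mathscr{S}_\lambda$, the rescaled nucleus $\lambda^{1/2}Z_\lambda$ converges in distribution as $\lambda\to\infty$ to the centered Gaussian distribution on $\mathbb{R}^2$ with covariance matrix $(4\pi)^{-1}$ times the identity matrix.
   Context: A convex body is a compact convex set with nonempty interior. For $\theta\in[0,2\pi)$, $u_\theta=(\cos\theta,\sin\theta)$, and $p_o(K,\theta)=\sup_{y\in K}\langle y,u_\theta\rangle$ is the support function of $K$ with respect to $o$. The Steiner point of $K$ is $\mathrm{st}(K)=\frac1\pi\int_0^{2\pi}p_o(K,\theta)\,u_\theta\,\mathrm{d}\theta$. For a locally finite set $\chi\subset\mathbb{R}^2$, its Voronoi tessellation is the collection of cells $\{y\in\mathbb{R}^2:\|y-x\|\le\|y-x'\|\ \text{for all }x'\in\chi\}$, $x\in\chi$; the point $x$ is the nucleus of its cell. *)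

theory Defs
  imports "HOL-Probability.Probability"
begin

definition convex_body :: "'a::euclidean_space set \<Rightarrow> bool" where
  "convex_body K \<longleftrightarrow> compact K \<and> convex K \<and> interior K \<noteq> {}"

definition unit_dir :: "real \<Rightarrow> real^2" where
  "unit_dir \<theta> = vector [cos \<theta>, sin \<theta>]"

definition support_fun :: "(real^2) set \<Rightarrow> real \<Rightarrow> real" where
  "support_fun K \<theta> = (SUP y\<in>K. y \<bullet> unit_dir \<theta>)"

definition steiner_point :: "(real^2) set \<Rightarrow> real^2" where
  "steiner_point K = (1 / pi) *\<^sub>R integral {0..2*pi} (\<lambda>\<theta>. support_fun K \<theta> *\<^sub>R unit_dir \<theta>)"

definition locally_finite_set :: "'a::metric_space set \<Rightarrow> bool" where
  "locally_finite_set A \<longleftrightarrow> (\<forall>B. bounded B \<longrightarrow> finite (A \<inter> B))"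

definition voronoi_cell :: "'a::real_normed_vector set \<Rightarrow> 'a \<Rightarrow> 'a set" where
  "voronoi_cell A x = {y. \<forall>x'\<in>A. norm (y - x) \<le> norm (y - x')}"

definition voronoi_tessellation :: "'a::real_normed_vector set \<Rightarrow> 'a set set" where
  "voronoi_tessellation A = voronoi_cell A ` A"

definition nucleus_containing :: "'a::real_normed_vector set \<Rightarrow> 'a set \<Rightarrow> 'a" where
  "nucleus_containing A K = (THE x. x \<in> A \<and> K \<subseteq> voronoi_cell A x)"

text \<open>The description above is proper as soon as some cell contains \<open>K\<close>
  and \<open>K\<close> has nonempty interior.\<close>

lemma ex1_nucleus_containing:
  fixes K A :: "'a::euclidean_space set"
  assumes "interior K \<noteq> {}" and "\<exists>C\<in>voronoi_tessellation A. K \<subseteq> C"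
  shows "\<exists>!x. x \<in> A \<and> K \<subseteq> voronoi_cell A x"
proof -
  from assms(2) obtain x where x: "x \<in> A" "K \<subseteq> voronoi_cell A x"
    by (auto simp: voronoi_tessellation_def)
  have "z = x" if z: "z \<in> A" "K \<subseteq> voronoi_cell A z" for z
  proof (rule ccontr)
    assume "z \<noteq> x"
    have "(2 *\<^sub>R (z - x)) \<bullet> y = z \<bullet> z - x \<bullet> x" if "y \<in> K" for y
    proof -
      have "norm (y - x) = norm (y - z)"
        using x z that unfolding voronoi_cell_def by (intro order_antisym) blast+
      then have "(y - x) \<bullet> (y - x) = (y - z) \<bullet> (y - z)"
        by (simp add: dot_square_norm)
      moreover have "(y - x) \<bullet> (y - x) = y \<bullet> y - 2 * (x \<bullet> y) + x \<bullet> x"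
        and "(y - z) \<bullet> (y - z) = y \<bullet> y - 2 * (z \<bullet> y) + z \<bullet> z"
        by (simp_all add: inner_diff_left inner_diff_right inner_commute)
      moreover have "(2 *\<^sub>R (z - x)) \<bullet> y = 2 * (z \<bullet> y) - 2 * (x \<bullet> y)"
        by (simp add: inner_diff_left)
      ultimately show ?thesis
        by linarith
    qed
    then have "K \<subseteq> {y. (2 *\<^sub>R (z - x)) \<bullet> y = z \<bullet> z - x \<bullet> x}"
      by blast
    then have "interior K \<subseteq> interior {y. (2 *\<^sub>R (z - x)) \<bullet> y = z \<bullet> z - x \<bullet> x}"
      by (rule interior_mono)
    also have "\<dots> = {}"
      using \<open>z \<noteq> x\<close> by (intro interior_hyperplane) simp
    finally show False
      using assms(1) by simp
  qed
  with x show ?thesis by blast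
qed

text \<open>The process is modelled as a random locally finite subset, a homogeneous Poisson
  process being simple. The Poisson probabilities are written out because the parameter
  may be \<open>0\<close>, which the library's \<open>poisson_pmf\<close> excludes.\<close>

definition homogeneous_poisson_process ::
    "'w measure \<Rightarrow> ('w \<Rightarrow> 'a::euclidean_space set) \<Rightarrow> real \<Rightarrow> bool" where
  "homogeneous_poisson_process M P l \<longleftrightarrow>
     prob_space M \<and>
     (\<forall>\<omega>\<in>space M. locally_finite_set (P \<omega>)) \<and>
     (\<forall>B\<in>sets borel. bounded B \<longrightarrow>
        (\<lambda>\<omega>. card (P \<omega> \<inter> B)) \<in> measurable M (count_space UNIV)) \<and>
     (\<forall>B\<in>sets borel. bounded B \<longrightarrow> (\<forall>k.
        measure M {\<omega>\<in>space M. card (P \<omega> \<inter> B) = k} =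
          exp (- (l * measure lborel B)) * (l * measure lborel B) ^ k / fact k)) \<and>
     (\<forall>(n::nat) B. (\<forall>i<n. B i \<in> sets borel \<and> bounded (B i)) \<longrightarrow>
        disjoint_family_on B {..<n} \<longrightarrow>
        prob_space.indep_vars M (\<lambda>_. count_space UNIV) (\<lambda>i \<omega>. card (P \<omega> \<inter> B i)) {..<n})"

definition cell_contains_event ::
    "'w measure \<Rightarrow> ('w \<Rightarrow> 'a::real_normed_vector set) \<Rightarrow> 'a set \<Rightarrow> 'w set" where
  "cell_contains_event M P K =
     {\<omega>\<in>space M. \<exists>C\<in>voronoi_tessellation (P \<omega>). K \<subseteq> C}"

text \<open>The law of \<open>X\<close> under \<open>M\<close> conditioned on the event \<open>S\<close>, that is
  \<open>A \<mapsto> M (S \<inter> X -` A) / M S\<close>. Restricting to \<open>S\<close> first makes it independent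
  of the values of \<open>X\<close> outside \<open>S\<close>, including their measurability.\<close>

definition conditional_law ::
    "'w measure \<Rightarrow> 'w set \<Rightarrow> ('w \<Rightarrow> 'a::topological_space) \<Rightarrow> 'a measure" where
  "conditional_law M S X = distr (uniform_measure (restrict_space M S) S) borel X"

text \<open>The library's \<open>weak_conv_m\<close> is restricted to sequences of measures on the real line.\<close>

definition converges_weakly ::
    "('i \<Rightarrow> 'a::topological_space measure) \<Rightarrow> 'a measure \<Rightarrow> 'i filter \<Rightarrow> bool" where
  "converges_weakly \<mu> \<nu> F \<longleftrightarrow>
     (\<forall>f :: 'a \<Rightarrow> real. continuous_on UNIV f \<longrightarrow> bounded (range f) \<longrightarrow>
        ((\<lambda>i. integral\<^sup>L (\<mu> i) f) \<longlongrightarrow> integral\<^sup>L \<nu> f) F)"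

text \<open>Mean \<open>m\<close> and (positive definite) covariance matrix \<open>C\<close>.\<close>

definition gaussian_measure :: "real^'n \<Rightarrow> real^'n^'n \<Rightarrow> (real^'n) measure" where
  "gaussian_measure m C = density lborel (\<lambda>x. ennreal
     (exp (- ((x - m) \<bullet> (matrix_inv C *v (x - m))) / 2) / sqrt ((2 * pi) ^ CARD('n) * det C)))"

end

theory Submission
  imports Defs
begin

text \<open>
  The cell of a point \<open>x\<close> of the process contains \<open>K\<close> iff the process has no points in the
  flower of \<open>x\<close>, the union of the discs centred at the points \<open>y\<close> of \<open>K\<close> and having \<open>x\<close> on
  their boundary. Hence, with \<open>V x\<close> denoting the area of the flower, the nucleus has density
  \<open>l * exp (- l * V x)\<close> on the event that it exists. This instance of the Mecke
  formula is obtained by discretisation: for a small set \<open>A\<close> the probability that \<open>A\<close>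
  contains the nucleus is squeezed by the Poisson probabilities of slightly thickened and
  thinned flowers.

  In polar coordinates around \<open>x\<close>, \<open>V x\<close> is the integral over \<open>t\<close> of
  \<open>2 * (max 0 (h t - x \<bullet> unit_dir t))\<^sup>2\<close>, where \<open>h\<close> is the support function of \<open>K\<close>. The Steiner
  point being an interior point of \<open>K\<close>, \<open>h\<close> is positive, and the linear term of the expansion
  of the square vanishes. So \<open>V x = V 0 + 2 * pi * (norm x)\<^sup>2\<close> near \<open>0\<close>, and \<open>V\<close> grows at least
  linearly. Rescaling by \<open>sqrt l\<close> and dominated convergence give the Gaussian limit.
\<close>

section \<open>Flowers\<close>

text \<open>The summand \<open>e\<close> alters every radius: \<open>e = 0\<close> gives the flower
  itself, positive \<open>e\<close> a thickened and negative \<open>e\<close> a thinned one. Discs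
  whose radius becomes nonpositive contribute nothing.\<close>

definition flower :: "'a::real_normed_vector set \<Rightarrow> real \<Rightarrow> 'a \<Rightarrow> 'a set" where
  "flower K e x = {z. \<exists>y\<in>K. norm (z - y) < norm (x - y) + e}"

lemma open_flower: "open (flower K e x)"
proof -
  have "flower K e x = (\<Union>y\<in>K. ball y (norm (x - y) + e))"
    by (auto simp: flower_def dist_norm norm_minus_commute)
  then show ?thesis by auto
qed

lemma flower_borel [measurable]: "flower K e x \<in> sets borel"
  by (simp add: open_flower)

lemma flower_subset_cball:
  assumes "\<And>y. y \<in> K \<Longrightarrow> norm y \<le> b"
  shows "flower K e x \<subseteq> cball 0 (2 * b + norm x + e)"
proof
  fix z assume "z \<in> flower K e x"
  then obtain y where y: "y \<in> K" "norm (z - y) < norm (x - y) + e"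
    by (auto simp: flower_def)
  have "norm z \<le> norm (z - y) + norm y" "norm (x - y) \<le> norm x + norm y"
    by (metis norm_triangle_sub add.commute) (rule norm_triangle_ineq4)
  then show "z \<in> cball 0 (2 * b + norm x + e)"
    using y assms[OF y(1)] by simp
qed

lemma bounded_flower:
  assumes "bounded K"
  shows "bounded (flower K e x)"
proof -
  obtain b where "\<And>y. y \<in> K \<Longrightarrow> norm y \<le> b"
    using assms by (auto simp: bounded_iff)
  then show ?thesis
    using bounded_subset[OF bounded_cball flower_subset_cball] by blast
qed

text \<open>Replacing \<open>x\<close> by \<open>x'\<close> changes each radius by at most
  \<open>norm (x - x')\<close>, and the difference of the parameters makes up for this. One flower
  with altered radii can thus stand for the flowers of all nearby points.\<close>

lemma flower_mono:
  assumes "norm (x - x') \<le> e' - e"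
  shows "flower K e x \<subseteq> flower K e' x'"
proof
  fix z assume "z \<in> flower K e x"
  then obtain y where y: "y \<in> K" "norm (z - y) < norm (x - y) + e"
    by (auto simp: flower_def)
  have "norm (x - y) \<le> norm (x - x') + norm (x' - y)"
    using norm_triangle_ineq[of "x - x'" "x' - y"] by simp
  then show "z \<in> flower K e' x'"
    using y assms unfolding flower_def by (intro CollectI bexI[of _ y]) auto
qed

lemma nucleus_notin_flower: "x \<notin> flower K 0 x"
  by (auto simp: flower_def)

lemma subset_voronoi_cell_iff: "K \<subseteq> voronoi_cell A x \<longleftrightarrow> A \<inter> flower K 0 x = {}"
proof -
  have "flower K 0 x = {z. \<exists>y\<in>K. norm (y - z) < norm (y - x)}"
    by (simp add: flower_def norm_minus_commute)
  then show ?thesis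
    unfolding voronoi_cell_def subset_iff disjoint_iff by (auto simp: not_less)
qed

text \<open>Apart from \<open>x\<close> itself, every ray from \<open>x\<close> meets this set at most once.\<close>

lemma negligible_flower_boundary:
  fixes K :: "'a::euclidean_space set"
  assumes "compact K"
  shows "negligible {z. (\<exists>y\<in>K. norm (z - y) \<le> norm (x - y)) \<and> z \<notin> flower K 0 x}"
proof -
  \<comment> \<open>The set in question, translated so that \<open>x\<close> becomes the origin,
    with the squared norms expanded: a quadratic term in \<open>w\<close> is compared with a linear
    one.\<close>
  define R where "R = {w. (\<exists>y\<in>K. w \<bullet> w \<le> 2 * (w \<bullet> (y - x))) \<and> (\<forall>y\<in>K. 2 * (w \<bullet> (y - x)) \<le> w \<bullet> w)}"
  have sq: "(x + w - y) \<bullet> (x + w - y) = (x - y) \<bullet> (x - y) + (w \<bullet> w - 2 * (w \<bullet> (y - x)))" for w y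
    by (simp add: inner_diff_left inner_diff_right inner_add_left inner_add_right inner_commute algebra_simps)
  have norm_le: "norm (x + w - y) \<le> norm (x - y) \<longleftrightarrow> w \<bullet> w \<le> 2 * (w \<bullet> (y - x))"
    and norm_ge: "norm (x - y) \<le> norm (x + w - y) \<longleftrightarrow> 2 * (w \<bullet> (y - x)) \<le> w \<bullet> w" for w y
    unfolding norm_le sq by auto
  define L where "L = {z. (\<exists>y\<in>K. norm (z - y) \<le> norm (x - y)) \<and> z \<notin> flower K 0 x}"
  have mem: "z \<in> L \<longleftrightarrow> z - x \<in> R" for z
    using norm_le[where w = "z - x"] norm_ge[where w = "z - x"]
    by (simp add: L_def R_def flower_def not_less)
  have eq: "L = (+) x ` R"
  proof (intro equalityI subsetI)
    show "z \<in> (+) x ` R" if "z \<in> L" for z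
      using that mem[of z] by (intro image_eqI[of _ _ "z - x"]) simp_all
    show "z \<in> L" if "z \<in> (+) x ` R" for z
      using that mem[of z] by auto
  qed
  \<comment> \<open>On a ray the quadratic side scales with \<open>c * c\<close> and the linear side
    with \<open>c\<close>, so \<open>w\<close> and its multiple by \<open>c\<close> both satisfy the
    conditions only for \<open>c = 1\<close>. Removing the origin rules out
    \<open>c = 0\<close>.\<close>
  have unique: "c = 1" if "c *\<^sub>R w \<in> R - {0}" "0 \<le> c" "w \<in> R - {0}" for c w
  proof -
    from that have c: "c > 0" and w: "w \<noteq> 0" by (auto simp: less_le)
    from that obtain y y' where y: "y \<in> K" "w \<bullet> w \<le> 2 * (w \<bullet> (y - x))"
      and y': "y' \<in> K" "(c *\<^sub>R w) \<bullet> (c *\<^sub>R w) \<le> 2 * ((c *\<^sub>R w) \<bullet> (y' - x))"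
      by (auto simp: R_def)
    from that y y' have "2 * ((c *\<^sub>R w) \<bullet> (y - x)) \<le> (c *\<^sub>R w) \<bullet> (c *\<^sub>R w)"
      and "2 * (w \<bullet> (y' - x)) \<le> w \<bullet> w"
      by (auto simp: R_def)
    with c y'(2) have "2 * (w \<bullet> (y - x)) \<le> c * (w \<bullet> w)" "c * (w \<bullet> w) \<le> w \<bullet> w"
      by auto
    with y(2) have "c * (w \<bullet> w) \<le> 1 * (w \<bullet> w)" "1 * (w \<bullet> w) \<le> c * (w \<bullet> w)" by auto
    then show ?thesis
      using w by (simp only: mult_le_cancel_right) auto
  qed
  have bd: "bounded L"
    by (rule bounded_subset[OF bounded_flower[OF compact_imp_bounded[OF assms], of 1 x]])
       (force simp: L_def flower_def)
  \<comment> \<open>A closed set of pairs is projected along the compact set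
    \<open>K\<close>.\<close>
  have "closed {z. \<exists>y. y \<in> K \<and> (y, z) \<in> {p. norm (snd p - fst p) \<le> norm (x - fst p)}}"
    by (intro closed_compact_projection[OF assms] closed_Collect_le continuous_intros)
  then have "closed ({z. \<exists>y\<in>K. norm (z - y) \<le> norm (x - y)} \<inter> - flower K 0 x)"
    using open_flower[of K 0 x] by (simp add: Bex_def closed_Int closed_Compl)
  then have cl: "closed L"
    by (simp add: L_def Int_def)
  have R: "R = (+) (- x) ` L"
    using eq by (simp add: image_comp o_def)
  have "compact R"
    unfolding R using bd cl by (intro compact_translation) (simp add: compact_eq_bounded_closed)
  then have "R - {0} \<in> sets lebesgue" "bounded (R - {0})"
    by (auto intro!: sets_completionI_sets sets.Diff borel_closed compact_imp_closed
        intro: bounded_subset compact_imp_bounded)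
  then have "R - {0} \<in> null_sets lebesgue"
    by (rule starlike_negligible_bounded_gmeasurable) (rule unique)
  then have "negligible (R - {0})"
    by (simp add: negligible_iff_null_sets)
  then have "negligible R"
    by (metis insert_Diff_single negligible_insert negligible_subset subset_insertI)
  then show ?thesis
    unfolding L_def[symmetric] eq by (rule negligible_translation)
qed

text \<open>Dominated convergence of indicator functions: they converge outside the null set of
  \<open>negligible_flower_boundary\<close>, and all the flowers lie in a common ball.\<close>

lemma measure_flower_tendsto:
  fixes K :: "'a::euclidean_space set"
  assumes K: "compact K" and c: "c \<longlonglongrightarrow> x" and e: "e \<longlonglongrightarrow> 0"
  shows "(\<lambda>n. measure lborel (flower K (e n) (c n))) \<longlonglongrightarrow> measure lborel (flower K 0 x)"
proof -
  obtain b where b: "\<And>y. y \<in> K \<Longrightarrow> norm y \<le> b"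
    using compact_imp_bounded[OF K] by (auto simp: bounded_iff)
  obtain r where r: "\<And>n. norm (c n) \<le> r"
    using convergent_imp_Bseq[OF convergentI[OF c]] by (auto simp: Bseq_def)
  obtain s where s: "\<And>n. \<bar>e n\<bar> \<le> s"
    using convergent_imp_Bseq[OF convergentI[OF e]] by (auto simp: Bseq_def)
  define B where "B = cball (0::'a) (2 * b + r + s)"
  have B: "emeasure lborel B < \<infinity>"
    unfolding B_def by (intro emeasure_bounded_finite) auto
  have sub: "flower K (e n) (c n) \<subseteq> B" for n
    using flower_subset_cball[OF b, of K "e n" "c n"] r[of n] s[of n] by (force simp: B_def)
  define N where "N = {z. (\<exists>y\<in>K. norm (z - y) \<le> norm (x - y)) \<and> z \<notin> flower K 0 x}"
  have "N \<in> null_sets (completion lborel)"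
    using negligible_flower_boundary[OF K, of x] by (simp add: N_def negligible_iff_null_sets)
  then have N: "AE z in lborel. z \<notin> N"
    using AE_not_in AE_completion_iff by blast
  have lim: "(\<lambda>n. indicator (flower K (e n) (c n)) z :: real) \<longlonglongrightarrow> indicator (flower K 0 x) z"
    if "z \<notin> N" for z
  proof (cases "z \<in> flower K 0 x")
    case True
    then obtain y where y: "y \<in> K" "norm (z - y) < norm (x - y)" by (auto simp: flower_def)
    have "(\<lambda>n. norm (c n - y) + e n) \<longlonglongrightarrow> norm (x - y) + 0"
      by (intro tendsto_intros c e)
    with y have "\<forall>\<^sub>F n in sequentially. norm (z - y) < norm (c n - y) + e n"
      by (intro order_tendstoD(1)[of _ "norm (x - y)"]) auto
    then have "\<forall>\<^sub>F n in sequentially. indicator (flower K (e n) (c n)) z = (1::real)"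
      by eventually_elim (use y in \<open>auto simp: flower_def indicator_def\<close>)
    with True show ?thesis by (simp add: tendsto_eventually)
  next
    case False
    have "\<forall>\<^sub>F n in sequentially. indicator (flower K (e n) (c n)) z = (0::real)"
    proof (cases "K = {}")
      case True
      then show ?thesis by (simp add: flower_def)
    next
      case nonempty: False
      \<comment> \<open>Compactness turns the strict inequalities for the single centres into a
        positive gap uniform in the centre, which outlasts small changes of \<open>x\<close> and of
        the radii.\<close>
      have "\<exists>y\<in>K. \<forall>y'\<in>K. norm (z - y) - norm (x - y) \<le> norm (z - y') - norm (x - y')"
        by (intro continuous_attains_inf K nonempty continuous_intros)
      then obtain y where y: "y \<in> K"
        "\<And>y'. y' \<in> K \<Longrightarrow> norm (z - y) - norm (x - y) \<le> norm (z - y') - norm (x - y')" by blast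
      have "norm (x - y) < norm (z - y)"
        using False \<open>z \<notin> N\<close> y(1) by (auto simp: N_def not_le)
      moreover have "(\<lambda>n. norm (c n - x) + e n) \<longlonglongrightarrow> norm (x - x) + 0"
        by (intro tendsto_intros c e)
      ultimately have "\<forall>\<^sub>F n in sequentially. norm (c n - x) + e n < norm (z - y) - norm (x - y)"
        by (intro order_tendstoD(2)[of _ 0]) auto
      then show ?thesis
      proof eventually_elim
        case (elim n)
        have "z \<notin> flower K (e n) (c n)"
        proof
          assume "z \<in> flower K (e n) (c n)"
          then obtain y' where y': "y' \<in> K" "norm (z - y') < norm (c n - y') + e n"
            by (auto simp: flower_def)
          have "norm (c n - y') \<le> norm (c n - x) + norm (x - y')"
            using norm_triangle_ineq[of "c n - x" "x - y'"] by simp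
          then show False using elim y' y(2)[of y'] by linarith
        qed
        then show ?case by simp
      qed
    qed
    with False show ?thesis by (simp add: tendsto_eventually)
  qed
  have "(\<lambda>n. \<integral>z. indicator (flower K (e n) (c n)) z \<partial>lborel)
      \<longlonglongrightarrow> (\<integral>z. (indicator (flower K 0 x) z :: real) \<partial>lborel)"
  proof (rule integral_dominated_convergence[where w = "indicator B"])
    show "integrable lborel (indicator B :: 'a \<Rightarrow> real)"
      using B by (simp add: B_def)
    show "AE z in lborel. (\<lambda>n. indicator (flower K (e n) (c n)) z :: real)
        \<longlonglongrightarrow> indicator (flower K 0 x) z"
      using N by eventually_elim (rule lim)
    show "AE z in lborel. norm (indicator (flower K (e n) (c n)) z :: real) \<le> indicator B z" for n
      using sub[of n] by (auto split: split_indicator)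
  qed auto
  then show ?thesis by simp
qed

section \<open>Discretisation by a cubic grid\<close>

text \<open>Each coordinate is rounded down to a multiple of \<open>1 / Suc n\<close>, so the
  nonempty fibres of \<open>grid n\<close> are countably many half-open cubes; \<open>Suc n\<close>
  keeps the divisor nonzero.\<close>

definition grid :: "nat \<Rightarrow> 'a::euclidean_space \<Rightarrow> 'a" where
  "grid n x = (\<Sum>b\<in>Basis. (of_int \<lfloor>real (Suc n) * (x \<bullet> b)\<rfloor> / real (Suc n)) *\<^sub>R b)"

text \<open>The summand \<open>1\<close> makes the bound on \<open>norm (x - grid n x)\<close> strict.\<close>

definition mesh :: "'a::euclidean_space itself \<Rightarrow> nat \<Rightarrow> real" where
  "mesh _ n = (real DIM('a) + 1) / real (Suc n)"

lemma mesh_tendsto: "mesh TYPE('a::euclidean_space) \<longlonglongrightarrow> 0"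
  unfolding mesh_def[abs_def] by (rule LIMSEQ_Suc[OF lim_const_over_n])

lemma grid_measurable [measurable]: "grid n \<in> borel_measurable borel"
proof -
  have "(\<lambda>x. real_of_int \<lfloor>real (Suc n) * (x \<bullet> b)\<rfloor>) \<in> borel_measurable borel" for b :: 'a
    by (rule measurable_compose[of "\<lambda>x. real (Suc n) * (x \<bullet> b)" _ borel]) measurable
  then show ?thesis
    unfolding grid_def[abs_def]
    by (intro borel_measurable_sum borel_measurable_scaleR borel_measurable_divide borel_measurable_const)
qed

lemma countable_range_grid: "countable (range (grid n :: 'a::euclidean_space \<Rightarrow> 'a))"
proof -
  define g :: "('a \<Rightarrow> int) \<Rightarrow> 'a" where
    "g = (\<lambda>h. \<Sum>b\<in>Basis. (of_int (h b) / real (Suc n)) *\<^sub>R b)"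
  have "grid n x \<in> g ` (Basis \<rightarrow>\<^sub>E UNIV)" for x
  proof (rule image_eqI)
    show "grid n x = g (restrict (\<lambda>b. \<lfloor>real (Suc n) * (x \<bullet> b)\<rfloor>) Basis)"
      unfolding grid_def g_def by (rule sum.cong) (simp_all only: restrict_apply if_True)
  qed (simp add: restrict_PiE_iff)
  then have "range (grid n) \<subseteq> g ` (Basis \<rightarrow>\<^sub>E UNIV)"
    by blast
  moreover have "countable (Basis \<rightarrow>\<^sub>E (UNIV :: int set) :: ('a \<Rightarrow> int) set)"
    by (rule countable_PiE) auto
  ultimately show ?thesis
    by (rule countable_subset[OF _ countable_image])
qed

text \<open>The norm is bounded by the sum of the absolute coordinates, each of which is at most
  \<open>1 / Suc n\<close>.\<close>

lemma norm_grid_less: "norm (x - grid n x) < mesh TYPE('a) n" for x :: "'a::euclidean_space"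
proof -
  have "\<bar>(x - grid n x) \<bullet> b\<bar> \<le> 1 / real (Suc n)" if "b \<in> Basis" for b
  proof -
    define m where "m = real (Suc n)"
    have m: "m > 0" by (simp add: m_def)
    have "\<bar>m * ((x - grid n x) \<bullet> b)\<bar> = \<bar>m * (x \<bullet> b) - of_int \<lfloor>m * (x \<bullet> b)\<rfloor>\<bar>"
      using that m unfolding grid_def m_def[symmetric]
      by (simp add: inner_diff_left right_diff_distrib)
    also have "\<dots> \<le> 1" by linarith
    finally show ?thesis
      using m unfolding m_def[symmetric] by (simp add: abs_mult pos_le_divide_eq mult.commute)
  qed
  then have "(\<Sum>b\<in>Basis. \<bar>(x - grid n x) \<bullet> b\<bar>) \<le> (\<Sum>b\<in>(Basis::'a set). 1 / real (Suc n))"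
    by (rule sum_mono)
  also have "\<dots> = real DIM('a) / real (Suc n)"
    by (simp only: sum_constant times_divide_eq_right mult_1_right)
  also have "\<dots> < mesh TYPE('a) n"
    unfolding mesh_def by (rule divide_strict_right_mono) auto
  finally show ?thesis
    using norm_le_l1[of "x - grid n x"] by linarith
qed

lemma grid_tendsto: "(\<lambda>n. grid n x) \<longlonglongrightarrow> x" for x :: "'a::euclidean_space"
proof (rule LIM_zero_cancel, rule Lim_null_comparison[OF always_eventually mesh_tendsto[where 'a='a]], rule allI)
  show "norm (grid n x - x) \<le> mesh TYPE('a) n" for n
    using norm_grid_less[of x n] by (simp add: norm_minus_commute)
qed

lemma bounded_grid_cell:
  fixes A :: "'a::euclidean_space set"
  shows "bounded (A \<inter> grid n -` {c})"
proof (rule bounded_subset[OF bounded_ball])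
  show "A \<inter> grid n -` {c} \<subseteq> ball c (mesh TYPE('a) n)"
  proof
    fix x assume "x \<in> A \<inter> grid n -` {c}"
    then show "x \<in> ball c (mesh TYPE('a) n)"
      using norm_grid_less[of x n] by (simp add: dist_norm norm_minus_commute)
  qed
qed

text \<open>Countable additivity over the fibres of \<open>q\<close>. It carries inequalities from
  small cells, where one flower approximates all the others, over to arbitrary Borel sets.\<close>

lemma emeasure_le_countable_partition:
  fixes q :: "'a \<Rightarrow> 'b"
  assumes sets: "sets M = sets N" and C: "countable (range q)"
    and q: "\<And>c. q -` {c} \<in> sets N" and A: "A \<in> sets N"
    and le: "\<And>c. emeasure M (A \<inter> q -` {c}) \<le> emeasure N (A \<inter> q -` {c})"
  shows "emeasure M A \<le> emeasure N A"
proof -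
  have A_eq: "A = (\<Union>c\<in>range q. A \<inter> q -` {c})" by auto
  have disj: "disjoint_family_on (\<lambda>c. A \<inter> q -` {c}) (range q)"
    by (auto simp: disjoint_family_on_def)
  have "emeasure M (\<Union>c\<in>range q. A \<inter> q -` {c}) \<le> emeasure N (\<Union>c\<in>range q. A \<inter> q -` {c})"
    using sets q A le C disj
    by (subst (1 2) emeasure_UN_countable) (auto intro!: nn_integral_mono)
  with A_eq show ?thesis by simp
qed

section \<open>Density of the nucleus\<close>

text \<open>By \<open>subset_voronoi_cell_iff\<close> this says that \<open>A\<close> contains the
  nucleus of a cell covering \<open>K\<close>. The formulation by flowers involves no choice of a
  nucleus and makes sense also where no such cell exists.\<close>

definition nucleus_event ::
    "'w measure \<Rightarrow> ('w \<Rightarrow> 'a::real_normed_vector set) \<Rightarrow> 'a set \<Rightarrow> 'a set \<Rightarrow> 'w set" where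
  "nucleus_event M P K A = {\<omega>\<in>space M. \<exists>x\<in>P \<omega> \<inter> A. P \<omega> \<inter> flower K 0 x = {}}"

section \<open>Poisson estimates and measurability of the nucleus events\<close>

locale poisson_process = prob_space M
  for M :: "'w measure" and P :: "'w \<Rightarrow> 'a::euclidean_space set" and l :: real +
  assumes hpp: "homogeneous_poisson_process M P l" and l_pos: "l > 0"
begin

lemma finite_points: "\<omega> \<in> space M \<Longrightarrow> bounded B \<Longrightarrow> finite (P \<omega> \<inter> B)"
  using hpp by (auto simp: homogeneous_poisson_process_def locally_finite_set_def)

lemma card_measurable:
  "B \<in> sets borel \<Longrightarrow> bounded B \<Longrightarrow> (\<lambda>\<omega>. card (P \<omega> \<inter> B)) \<in> measurable M (count_space UNIV)"
  using hpp by (auto simp: homogeneous_poisson_process_def)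

lemma card_event:
  "B \<in> sets borel \<Longrightarrow> bounded B \<Longrightarrow> {\<omega>\<in>space M. Q (card (P \<omega> \<inter> B))} \<in> events"
  using measurable_sets[OF card_measurable, of B "{k. Q k}"]
  by (simp add: vimage_def Int_def conj_commute)

lemma prob_card:
  "B \<in> sets borel \<Longrightarrow> bounded B \<Longrightarrow>
    prob {\<omega>\<in>space M. card (P \<omega> \<inter> B) = k} =
      exp (- (l * measure lborel B)) * (l * measure lborel B) ^ k / fact k"
  using hpp by (auto simp: homogeneous_poisson_process_def)

lemma prob_card_disjoint:
  assumes "A \<in> sets borel" "bounded A" "B \<in> sets borel" "bounded B" "A \<inter> B = {}"
  shows "prob {\<omega>\<in>space M. Q (card (P \<omega> \<inter> A)) \<and> R (card (P \<omega> \<inter> B))} =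
    prob {\<omega>\<in>space M. Q (card (P \<omega> \<inter> A))} * prob {\<omega>\<in>space M. R (card (P \<omega> \<inter> B))}"
proof -
  define C where "C = (\<lambda>i::nat. if i = 0 then A else B)"
  define D where "D = (\<lambda>i::nat. if i = 0 then {k. Q k} else {k. R k})"
  have "\<forall>i<2. C i \<in> sets borel \<and> bounded (C i)" "disjoint_family_on C {..<2}"
    using assms by (auto simp: C_def disjoint_family_on_def)
  then have "indep_vars (\<lambda>_. count_space UNIV) (\<lambda>i \<omega>. card (P \<omega> \<inter> C i)) {..<2}"
    using hpp unfolding homogeneous_poisson_process_def by blast
  then have "prob (\<Inter>i\<in>{..<2}. (\<lambda>\<omega>. card (P \<omega> \<inter> C i)) -` D i \<inter> space M) =
      (\<Prod>i\<in>{..<2}. prob ((\<lambda>\<omega>. card (P \<omega> \<inter> C i)) -` D i \<inter> space M))"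
    by (rule indep_varsD_finite) (auto simp: lessThan_empty_iff)
  moreover have "{..<2::nat} = {0, 1}" by auto
  ultimately have "prob (((\<lambda>\<omega>. card (P \<omega> \<inter> A)) -` {k. Q k} \<inter> space M) \<inter>
        ((\<lambda>\<omega>. card (P \<omega> \<inter> B)) -` {k. R k} \<inter> space M)) =
      prob ((\<lambda>\<omega>. card (P \<omega> \<inter> A)) -` {k. Q k} \<inter> space M) *
      prob ((\<lambda>\<omega>. card (P \<omega> \<inter> B)) -` {k. R k} \<inter> space M)"
    by (simp add: C_def D_def)
  moreover have "(\<lambda>\<omega>. card (P \<omega> \<inter> A)) -` {k. Q k} \<inter> space M = {\<omega>\<in>space M. Q (card (P \<omega> \<inter> A))}"
    "(\<lambda>\<omega>. card (P \<omega> \<inter> B)) -` {k. R k} \<inter> space M = {\<omega>\<in>space M. R (card (P \<omega> \<inter> B))}"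
    "{\<omega>\<in>space M. Q (card (P \<omega> \<inter> A))} \<inter> {\<omega>\<in>space M. R (card (P \<omega> \<inter> B))} =
      {\<omega>\<in>space M. Q (card (P \<omega> \<inter> A)) \<and> R (card (P \<omega> \<inter> B))}"
    by auto
  ultimately show ?thesis by simp
qed

text \<open>The flowers of all points of \<open>A\<close> lie between \<open>flower K (- e) c\<close> and \<open>flower K e c\<close>; the
  former is disjoint from \<open>A\<close> and the latter contains it.\<close>

lemma prob_nucleus_event_le:
  assumes K: "bounded K" and A: "A \<in> sets borel" "bounded A"
    and small: "\<And>x. x \<in> A \<Longrightarrow> norm (x - c) < e"
  shows "prob (nucleus_event M P K A) \<le>
    l * measure lborel A * exp (- (l * measure lborel (flower K (- e) c)))"
proof -
  let ?F = "flower K (- e) c"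
  have F: "?F \<in> sets borel" "bounded ?F"
    using K by (simp_all add: bounded_flower)
  \<comment> \<open>Disjointness makes the counts in \<open>A\<close> and in the thinned flower
    independent.\<close>
  have disj: "A \<inter> ?F = {}"
  proof (rule ccontr)
    assume "A \<inter> ?F \<noteq> {}"
    then obtain x y where "x \<in> A" "norm (x - y) < norm (c - y) - e"
      by (auto simp: flower_def)
    moreover have "norm (c - y) \<le> norm (x - c) + norm (x - y)"
      using norm_triangle_ineq[of "c - x" "x - y"] by (simp add: norm_minus_commute)
    ultimately show False using small[of x] by linarith
  qed
  have "nucleus_event M P K A \<subseteq>
      {\<omega>\<in>space M. card (P \<omega> \<inter> A) \<noteq> 0 \<and> card (P \<omega> \<inter> ?F) = 0}"
  proof
    fix \<omega> assume "\<omega> \<in> nucleus_event M P K A"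
    then obtain x where x: "\<omega> \<in> space M" "x \<in> P \<omega>" "x \<in> A" "P \<omega> \<inter> flower K 0 x = {}"
      by (auto simp: nucleus_event_def)
    have "?F \<subseteq> flower K 0 x"
      using small[OF x(3)] by (intro flower_mono) (simp add: norm_minus_commute)
    with x have "P \<omega> \<inter> ?F = {}" by blast
    moreover have "card (P \<omega> \<inter> A) \<noteq> 0"
      using x finite_points[OF x(1) A(2)] by auto
    ultimately show "\<omega> \<in> {\<omega>\<in>space M. card (P \<omega> \<inter> A) \<noteq> 0 \<and> card (P \<omega> \<inter> ?F) = 0}"
      using x(1) by simp
  qed
  then have "prob (nucleus_event M P K A) \<le>
      prob {\<omega>\<in>space M. card (P \<omega> \<inter> A) \<noteq> 0 \<and> card (P \<omega> \<inter> ?F) = 0}"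
  proof (rule finite_measure_mono)
    have "{\<omega>\<in>space M. card (P \<omega> \<inter> A) \<noteq> 0} \<inter> {\<omega>\<in>space M. card (P \<omega> \<inter> ?F) = 0} \<in> events"
      using A F by (intro sets.Int card_event)
    then show "{\<omega>\<in>space M. card (P \<omega> \<inter> A) \<noteq> 0 \<and> card (P \<omega> \<inter> ?F) = 0} \<in> events"
      by (simp add: Int_def conj_ac cong: conj_cong)
  qed
  also have "\<dots> = prob {\<omega>\<in>space M. card (P \<omega> \<inter> A) \<noteq> 0} * prob {\<omega>\<in>space M. card (P \<omega> \<inter> ?F) = 0}"
    using A F disj by (rule prob_card_disjoint)
  also have "prob {\<omega>\<in>space M. card (P \<omega> \<inter> A) \<noteq> 0} = 1 - exp (- (l * measure lborel A))"
    using prob_neg[OF card_event, of A "\<lambda>k. k = 0"] prob_card[of A 0] A by simp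
  also have "prob {\<omega>\<in>space M. card (P \<omega> \<inter> ?F) = 0} = exp (- (l * measure lborel ?F))"
    using prob_card[of ?F 0] F by simp
  \<comment> \<open>This is \<open>1 - exp (- u) \<le> u\<close> with
    \<open>u = l * measure lborel A\<close>.\<close>
  also have "(1 - exp (- (l * measure lborel A))) * exp (- (l * measure lborel ?F)) \<le>
      l * measure lborel A * exp (- (l * measure lborel ?F))"
    using exp_ge_add_one_self[of "- (l * measure lborel A)"] by (intro mult_right_mono) auto
  finally show ?thesis .
qed

lemma prob_nucleus_event_ge:
  assumes K: "bounded K" "K \<noteq> {}" and A: "A \<in> sets borel" "bounded A"
    and small: "\<And>x. x \<in> A \<Longrightarrow> norm (x - c) < e" and E: "nucleus_event M P K A \<in> events"
  shows "l * measure lborel A * exp (- (l * measure lborel (flower K e c))) \<le>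
    prob (nucleus_event M P K A)"
proof -
  let ?F = "flower K e c"
  have F: "?F \<in> sets borel" "bounded ?F"
    using K by (simp_all add: bounded_flower)
  have FA: "?F - A \<in> sets borel" "bounded (?F - A)"
    using F A by (auto intro: bounded_subset)
  have sub: "A \<subseteq> ?F"
  proof
    fix x assume "x \<in> A"
    moreover obtain y where "y \<in> K" using K(2) by blast
    moreover have "norm (x - y) \<le> norm (x - c) + norm (c - y)"
      using norm_triangle_ineq[of "x - c" "c - y"] by simp
    ultimately show "x \<in> ?F" using small[of x] unfolding flower_def by force
  qed
  have fin: "emeasure lborel A \<noteq> \<infinity>" "emeasure lborel ?F \<noteq> \<infinity>"
    using emeasure_bounded_finite[OF A(2)] emeasure_bounded_finite[OF F(2)] by auto
  have "measure lborel (?F - A) = measure lborel ?F - measure lborel A"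
    using F A fin sub by (intro measure_Diff) auto
  \<comment> \<open>The factor \<open>exp (- (l * measure lborel A))\<close> in the probability of
    exactly one point in \<open>A\<close> completes the void probability of \<open>?F - A\<close> to
    that of \<open>?F\<close>.\<close>
  then have "exp (- (l * measure lborel A)) * exp (- (l * measure lborel (?F - A))) =
      exp (- (l * measure lborel ?F))"
    by (simp add: exp_add[symmetric] right_diff_distrib)
  then have "l * measure lborel A * exp (- (l * measure lborel ?F)) =
      prob {\<omega>\<in>space M. card (P \<omega> \<inter> A) = 1} * prob {\<omega>\<in>space M. card (P \<omega> \<inter> (?F - A)) = 0}"
    using prob_card[of A 1] prob_card[of "?F - A" 0] A FA by (simp add: ac_simps)
  also have "\<dots> = prob {\<omega>\<in>space M. card (P \<omega> \<inter> A) = 1 \<and> card (P \<omega> \<inter> (?F - A)) = 0}"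
    using A FA by (intro prob_card_disjoint[symmetric]) auto
  also have "\<dots> \<le> prob (nucleus_event M P K A)"
  \<comment> \<open>Here \<open>x\<close> is the only point of the process in \<open>?F\<close>. Its
    own flower lies in \<open>?F\<close> and omits \<open>x\<close>, hence contains no point of the
    process.\<close>
  proof (rule finite_measure_mono[OF _ E], rule subsetI)
    fix \<omega> assume "\<omega> \<in> {\<omega>\<in>space M. card (P \<omega> \<inter> A) = 1 \<and> card (P \<omega> \<inter> (?F - A)) = 0}"
    then have \<omega>: "\<omega> \<in> space M" "card (P \<omega> \<inter> A) = 1" "P \<omega> \<inter> (?F - A) = {}"
      using finite_points[of \<omega>, OF _ FA(2)] by auto
    then obtain x where x: "P \<omega> \<inter> A = {x}" by (auto simp: card_1_singleton_iff)
    then have "flower K 0 x \<subseteq> ?F"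
      using small[of x] by (intro flower_mono) (auto intro: less_imp_le)
    then have "P \<omega> \<inter> flower K 0 x \<subseteq> {x} \<inter> flower K 0 x"
      using \<omega> x by blast
    then have "P \<omega> \<inter> flower K 0 x = {}"
      using nucleus_notin_flower[of x K] by blast
    then show "\<omega> \<in> nucleus_event M P K A"
      using \<omega> x by (auto simp: nucleus_event_def)
  qed
  finally show ?thesis .
qed

text \<open>The process provides measurability for counts in bounded Borel sets. Approximating the
  flowers by those of grid points expresses the event through countably many such counts.\<close>

lemma nucleus_event_bounded:
  assumes K: "bounded K" and A: "A \<in> sets borel" "bounded A"
  shows "nucleus_event M P K A \<in> events"
proof -
  \<comment> \<open>The process has a point in the part of \<open>A\<close> rounded to
    \<open>c\<close>, and none in the thinned flower of \<open>c\<close>.\<close>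
  define G where "G = (\<lambda>n c. {\<omega>\<in>space M. card (P \<omega> \<inter> (A \<inter> grid n -` {c})) \<noteq> 0} \<inter>
    {\<omega>\<in>space M. card (P \<omega> \<inter> flower K (- mesh TYPE('a) n) c) = 0})"
  have "G n c \<in> events" for n c
    unfolding G_def using A K bounded_grid_cell[of A n c] measurable_sets[OF grid_measurable, of "{c}" n]
    by (intro sets.Int card_event bounded_flower flower_borel) auto
  then have "(\<Union>c\<in>range (grid n). G n c) \<in> events" for n
    by (rule sets.countable_UN''[OF countable_range_grid])
  then have G: "(\<Inter>n. \<Union>c\<in>range (grid n). G n c) \<in> events"
    by (intro sets.countable_INT) auto
  have mem: "\<omega> \<in> G n (grid n x) \<longleftrightarrow>
      \<omega> \<in> space M \<and> (\<exists>z\<in>P \<omega> \<inter> A. grid n z = grid n x) \<and>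
      P \<omega> \<inter> flower K (- mesh TYPE('a) n) (grid n x) = {}" for \<omega> n x
  proof (cases "\<omega> \<in> space M")
    case True
    then show ?thesis
      using finite_points[OF True bounded_grid_cell[of A n "grid n x"]]
        finite_points[OF True bounded_flower[OF K, of "- mesh TYPE('a) n" "grid n x"]]
      by (simp add: G_def card_eq_0_iff) blast
  qed (simp add: G_def)
  have "nucleus_event M P K A = (\<Inter>n. \<Union>c\<in>range (grid n). G n c)"
  proof (intro equalityI subsetI)
    fix \<omega> assume "\<omega> \<in> nucleus_event M P K A"
    then obtain x where x: "\<omega> \<in> space M" "x \<in> P \<omega>" "x \<in> A" "P \<omega> \<inter> flower K 0 x = {}"
      by (auto simp: nucleus_event_def)
    have "flower K (- mesh TYPE('a) n) (grid n x) \<subseteq> flower K 0 x" for n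
      using norm_grid_less[of x n] by (intro flower_mono) (simp add: norm_minus_commute)
    then have "\<omega> \<in> G n (grid n x)" for n
      unfolding mem using x by blast
    then show "\<omega> \<in> (\<Inter>n. \<Union>c\<in>range (grid n). G n c)" by blast
  next
    fix \<omega> assume \<omega>: "\<omega> \<in> (\<Inter>n. \<Union>c\<in>range (grid n). G n c)"
    have "\<exists>z\<in>P \<omega> \<inter> A. P \<omega> \<inter> flower K (- mesh TYPE('a) n) (grid n z) = {}" for n
    proof -
      from \<omega> obtain x where "\<omega> \<in> G n (grid n x)" by blast
      then show ?thesis unfolding mem by metis
    qed
    then obtain z where z: "\<And>n. z n \<in> P \<omega> \<inter> A"
      "\<And>n. P \<omega> \<inter> flower K (- mesh TYPE('a) n) (grid n (z n)) = {}" by metis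
    have sp: "\<omega> \<in> space M" using \<omega> by (auto simp: G_def)
    \<comment> \<open>The points \<open>z n\<close> come from the finite set
      \<open>P \<omega> \<inter> A\<close>, so one of them recurs infinitely often; it serves as the
      nucleus.\<close>
    have "finite (range z)"
      using finite_points[OF sp A(2)] z(1) by (rule_tac finite_subset) auto
    then obtain x where x: "x \<in> range z" "infinite (z -` {x})"
      using inf_img_fin_domE[of z UNIV] by auto
    have "P \<omega> \<inter> flower K 0 x = {}"
    proof (rule ccontr)
      assume "P \<omega> \<inter> flower K 0 x \<noteq> {}"
      then obtain p y where p: "p \<in> P \<omega>" "y \<in> K" "norm (p - y) < norm (x - y)"
        by (auto simp: flower_def)
      \<comment> \<open>A point strictly inside a disc of the flower of \<open>x\<close> also lies
        in the thinned flowers of \<open>grid n x\<close> for all large \<open>n\<close>.\<close>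
      have "(\<lambda>n. norm (grid n x - y) - mesh TYPE('a) n) \<longlonglongrightarrow> norm (x - y) - 0"
        by (intro tendsto_intros grid_tendsto mesh_tendsto)
      with p have "\<forall>\<^sub>F n in sequentially. norm (p - y) < norm (grid n x - y) - mesh TYPE('a) n"
        by (intro order_tendstoD(1)[of _ "norm (x - y)"]) auto
      then obtain N where N: "\<And>n. n \<ge> N \<Longrightarrow> norm (p - y) < norm (grid n x - y) - mesh TYPE('a) n"
        by (auto simp: eventually_sequentially)
      obtain n where n: "n \<ge> N" "z n = x"
        using x(2) by (metis infinite_nat_iff_unbounded_le vimage_singleton_eq)
      from N[OF n(1)] have "p \<in> flower K (- mesh TYPE('a) n) (grid n (z n))"
        using p(2) n(2) by (auto simp: flower_def)
      with z(2)[of n] p(1) show False by blast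
    qed
    moreover have "x \<in> P \<omega> \<inter> A" using x(1) z(1) by auto
    ultimately show "\<omega> \<in> nucleus_event M P K A"
      using sp by (auto simp: nucleus_event_def)
  qed
  with G show ?thesis by simp
qed

text \<open>The cubes of \<open>grid 0\<close> cut \<open>A\<close> into countably many bounded
  pieces.\<close>

lemma nucleus_event_measurable:
  assumes K: "bounded K" and A: "A \<in> sets borel"
  shows "nucleus_event M P K A \<in> events"
proof -
  have "nucleus_event M P K A =
      (\<Union>c\<in>range (grid 0). nucleus_event M P K (A \<inter> grid 0 -` {c}))"
    by (auto simp: nucleus_event_def)
  moreover have "nucleus_event M P K (A \<inter> grid 0 -` {c}) \<in> events" for c
    using measurable_sets[OF grid_measurable, of "{c}" 0] A
    by (intro nucleus_event_bounded K bounded_grid_cell) auto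
  ultimately show ?thesis
    by (simp only: sets.countable_UN''[OF countable_range_grid])
qed

end

section \<open>The law of the nucleus\<close>

text \<open>\<open>grid n\<close> has countable range and measurable fibres, so an arbitrary
  \<open>h\<close> becomes measurable when composed with it.\<close>

lemma measurable_grid_compose:
  "(\<lambda>x. h (grid n x)) \<in> borel_measurable (borel :: 'a::euclidean_space measure)"
proof -
  have "grid n \<in> measurable (borel :: 'a measure) (count_space (range (grid n)))"
    using measurable_sets[OF grid_measurable[where 'a='a]]
    by (subst measurable_count_space_eq_countable[OF countable_range_grid]) auto
  then show ?thesis
    by (rule measurable_compose_countable'[where f="\<lambda>c _. h c", OF _ _ countable_range_grid, rotated]) simp
qed

lemma cell_contains_event_eq: "cell_contains_event M P K = nucleus_event M P K UNIV"
  by (auto simp: cell_contains_event_def nucleus_event_def voronoi_tessellation_def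
      subset_voronoi_cell_iff)

text \<open>Uniqueness of the nucleus, due to the nonempty interior of \<open>K\<close>, identifies
  the definite description with any witness of \<open>nucleus_event\<close>.\<close>

lemma nucleus_in_iff:
  fixes K :: "'a::euclidean_space set"
  assumes "interior K \<noteq> {}" and "\<omega> \<in> cell_contains_event M P K"
  shows "nucleus_containing (P \<omega>) K \<in> A \<longleftrightarrow> \<omega> \<in> nucleus_event M P K A"
proof -
  have \<omega>: "\<omega> \<in> space M" "\<exists>C\<in>voronoi_tessellation (P \<omega>). K \<subseteq> C"
    using assms(2) by (auto simp: cell_contains_event_def)
  note ex1 = ex1_nucleus_containing[OF assms(1) \<omega>(2)]
  define x where "x = nucleus_containing (P \<omega>) K"
  have x: "x \<in> P \<omega> \<and> K \<subseteq> voronoi_cell (P \<omega>) x"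
    unfolding x_def nucleus_containing_def by (rule theI'[OF ex1])
  have "y = x" if "y \<in> P \<omega>" "K \<subseteq> voronoi_cell (P \<omega>) y" for y
    using ex1 x that by blast
  then have "x \<in> A \<longleftrightarrow> (\<exists>y\<in>P \<omega> \<inter> A. K \<subseteq> voronoi_cell (P \<omega>) y)"
    using x by blast
  then show ?thesis
    using \<omega>(1) by (simp add: x_def[symmetric] nucleus_event_def subset_voronoi_cell_iff)
qed

text \<open>The function is a pointwise limit of step functions, obtained by moving \<open>x\<close>
  to grid points.\<close>

lemma measure_flower_measurable:
  fixes K :: "'a::euclidean_space set"
  assumes K: "compact K"
  shows "(\<lambda>x. measure lborel (flower K 0 x)) \<in> borel_measurable borel"
proof (rule borel_measurable_LIMSEQ_real)
  show "(\<lambda>n. measure lborel (flower K 0 (grid n x))) \<longlonglongrightarrow> measure lborel (flower K 0 x)" for x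
    by (rule measure_flower_tendsto[OF K grid_tendsto tendsto_const])
qed (rule measurable_grid_compose)

context poisson_process
begin

context
  fixes K :: "'a set" and Z :: "'w \<Rightarrow> 'a"
  assumes K: "compact K" "interior K \<noteq> {}"
    and Z: "\<forall>\<omega>\<in>cell_contains_event M P K. Z \<omega> = nucleus_containing (P \<omega>) K"
begin

lemma cell_contains_event_measurable: "cell_contains_event M P K \<in> events"
  by (simp add: cell_contains_event_eq nucleus_event_measurable compact_imp_bounded K)

text \<open>\<open>Z\<close> is prescribed only where the nucleus exists, hence the intersection
  with that event.\<close>

lemma vimage_nucleus:
  "Z -` A \<inter> cell_contains_event M P K = nucleus_event M P K A"
proof -
  have "nucleus_event M P K A \<subseteq> cell_contains_event M P K"
    by (auto simp: cell_contains_event_eq nucleus_event_def)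
  then show ?thesis
    using Z nucleus_in_iff[OF K(2), of _ M P A] by auto
qed

lemma space_restrict_cell_event:
  "space (restrict_space M (cell_contains_event M P K)) = cell_contains_event M P K"
  using sets.sets_into_space[OF cell_contains_event_measurable] by (auto simp: space_restrict_space)

lemma nucleus_measurable: "Z \<in> borel_measurable (restrict_space M (cell_contains_event M P K))"
proof (rule measurableI)
  fix A :: "'a set" assume "A \<in> sets borel"
  then have "nucleus_event M P K A \<in> events"
    by (simp add: nucleus_event_measurable compact_imp_bounded K)
  then show "Z -` A \<inter> space (restrict_space M (cell_contains_event M P K)) \<in>
      sets (restrict_space M (cell_contains_event M P K))"
    using cell_contains_event_measurable
    by (simp add: space_restrict_cell_event vimage_nucleus sets_restrict_space_iff)
       (auto simp flip: vimage_nucleus)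
qed simp

lemma emeasure_distr_nucleus:
  assumes A: "A \<in> sets borel"
  shows "emeasure (distr (restrict_space M (cell_contains_event M P K)) borel Z) A =
    ennreal (prob (nucleus_event M P K A))"
proof -
  have "nucleus_event M P K A \<subseteq> cell_contains_event M P K"
    by (auto simp flip: vimage_nucleus)
  then show ?thesis
    using A cell_contains_event_measurable emeasure_distr[OF nucleus_measurable A]
    unfolding space_restrict_cell_event vimage_nucleus
    by (simp add: emeasure_restrict_space emeasure_eq_measure)
qed

text \<open>The left side is not normalised: its total mass is the probability of the event. On a
  grid cell it lies between the measures with densities \<open>h 1 n\<close> and
  \<open>h (- 1) n\<close>, by the two Poisson estimates, and both densities converge to the stated
  one.\<close>

theorem distr_nucleus:
  "distr (restrict_space M (cell_contains_event M P K)) borel Z =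
    density lborel (\<lambda>x. ennreal (l * exp (- (l * measure lborel (flower K 0 x)))))"
    (is "?\<mu> = density lborel ?f")
proof -
  have bK: "bounded K" "K \<noteq> {}"
    using K by (auto simp: compact_imp_bounded)
  have E: "nucleus_event M P K A \<in> events" if "A \<in> sets borel" for A
    using that by (simp add: nucleus_event_measurable bK)
  \<comment> \<open>\<open>s = 1\<close> uses thickened flowers and gives lower bounds,
    \<open>s = - 1\<close> thinned ones and upper bounds. Both functions are constant on grid
    cells.\<close>
  define h where "h = (\<lambda>s n x. l * exp (- (l * measure lborel (flower K (s * mesh TYPE('a) n) (grid n x)))))"
  have h_meas [measurable]: "h s n \<in> borel_measurable borel" for s n
    unfolding h_def by (rule measurable_grid_compose)
  have h_lim: "(\<lambda>n. h s n x) \<longlonglongrightarrow> l * exp (- (l * measure lborel (flower K 0 x)))" for s x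
    unfolding h_def
    by (rule tendsto_mult[OF tendsto_const] tendsto_exp tendsto_minus measure_flower_tendsto K
        grid_tendsto tendsto_mult_right_zero mesh_tendsto)+
  have h_bound: "0 \<le> h s n x" "h s n x \<le> l" for s n x
    using l_pos by (auto simp: h_def mult_le_cancel_left1)
  have f_meas [measurable]: "?f \<in> borel_measurable lborel"
  proof -
    have "(\<lambda>x. l * exp (- (l * measure lborel (flower K 0 x)))) \<in> borel_measurable borel"
      by (rule borel_measurable_LIMSEQ_real[OF h_lim h_meas])
    then show ?thesis by simp
  qed
  have piece: "emeasure (density lborel (\<lambda>x. ennreal (h s n x))) (A \<inter> grid n -` {c}) =
      ennreal (l * measure lborel (A \<inter> grid n -` {c}) *
        exp (- (l * measure lborel (flower K (s * mesh TYPE('a) n) c))))"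
    if A [measurable]: "A \<in> sets borel" for A n c s
  proof -
    let ?A = "A \<inter> grid n -` {c}"
    have A' [measurable]: "?A \<in> sets borel"
      using measurable_sets[OF grid_measurable, of "{c}" n] A by auto
    have "emeasure (density lborel (\<lambda>x. ennreal (h s n x))) ?A =
        (\<integral>\<^sup>+x. ennreal (h s n x) * indicator ?A x \<partial>lborel)"
      by (rule emeasure_density) auto
    also have "\<dots> = (\<integral>\<^sup>+x. ennreal (l * exp (- (l * measure lborel (flower K (s * mesh TYPE('a) n) c)))) * indicator ?A x \<partial>lborel)"
      by (intro nn_integral_cong) (auto simp: h_def split: split_indicator)
    also have "\<dots> = ennreal (l * exp (- (l * measure lborel (flower K (s * mesh TYPE('a) n) c)))) * emeasure lborel ?A"
      by (rule nn_integral_cmult_indicator) auto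
    also have "emeasure lborel ?A = ennreal (measure lborel ?A)"
      using emeasure_bounded_finite[OF bounded_grid_cell[of A n c]]
      by (intro emeasure_eq_ennreal_measure) auto
    finally show ?thesis
      using l_pos by (simp add: ennreal_mult'[symmetric] ac_simps)
  qed
  have small: "norm (x - c) < mesh TYPE('a) n" if "x \<in> A \<inter> grid n -` {c}" for x c :: 'a and A n
    using that norm_grid_less[of x n] by auto
  have grid_sets: "grid n -` {c} \<in> sets borel" for n and c :: 'a
    using measurable_sets[OF grid_measurable, of "{c}" n] by simp
  have le: "emeasure ?\<mu> A \<le> emeasure (density lborel (\<lambda>x. ennreal (h (- 1) n x))) A"
    if A: "A \<in> sets borel" for A n
  proof (rule emeasure_le_countable_partition[where q="grid n", OF _ countable_range_grid])
    fix c
    have "A \<inter> grid n -` {c} \<in> sets borel" using A grid_sets by auto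
    then show "emeasure ?\<mu> (A \<inter> grid n -` {c}) \<le>
        emeasure (density lborel (\<lambda>x. ennreal (h (- 1) n x))) (A \<inter> grid n -` {c})"
      unfolding piece[OF A] mult_minus1
      by (simp only: emeasure_distr_nucleus)
         (intro ennreal_leI prob_nucleus_event_le[OF bK(1) _ bounded_grid_cell small])
  qed (use A grid_sets in auto)
  have ge: "emeasure (density lborel (\<lambda>x. ennreal (h 1 n x))) A \<le> emeasure ?\<mu> A"
    if A: "A \<in> sets borel" for A n
  proof (rule emeasure_le_countable_partition[where q="grid n", OF _ countable_range_grid])
    fix c
    have "A \<inter> grid n -` {c} \<in> sets borel" using A grid_sets by auto
    then show "emeasure (density lborel (\<lambda>x. ennreal (h 1 n x))) (A \<inter> grid n -` {c}) \<le>
        emeasure ?\<mu> (A \<inter> grid n -` {c})"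
      unfolding piece[OF A] mult_1
      by (simp only: emeasure_distr_nucleus)
         (intro ennreal_leI prob_nucleus_event_ge[OF bK _ bounded_grid_cell small E])
  qed (use A grid_sets in auto)
  \<comment> \<open>Boundedness of \<open>A\<close> makes the constant \<open>l\<close> an
    integrable majorant on \<open>A\<close>.\<close>
  have lim: "(\<lambda>n. emeasure (density lborel (\<lambda>x. ennreal (h s n x))) A) \<longlonglongrightarrow> emeasure (density lborel ?f) A"
    if A [measurable]: "A \<in> sets borel" and "bounded A" for A s
  proof -
    have "(\<lambda>n. \<integral>\<^sup>+x. ennreal (h s n x) * indicator A x \<partial>lborel) \<longlonglongrightarrow> (\<integral>\<^sup>+x. ?f x * indicator A x \<partial>lborel)"
    proof (rule nn_integral_dominated_convergence[where w="\<lambda>x. ennreal l * indicator A x"])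
      show "(\<integral>\<^sup>+x. ennreal l * indicator A x \<partial>lborel) < \<infinity>"
        using emeasure_bounded_finite[OF \<open>bounded A\<close>]
        by (subst nn_integral_cmult_indicator) (auto simp: ennreal_mult_less_top)
      show "AE x in lborel. ennreal (h s n x) * indicator A x \<le> ennreal l * indicator A x" for n
        using h_bound by (auto split: split_indicator intro!: ennreal_leI)
      show "AE x in lborel. (\<lambda>n. ennreal (h s n x) * indicator A x) \<longlonglongrightarrow> ?f x * indicator A x"
        using h_lim by (auto split: split_indicator intro!: tendsto_ennrealI)
    qed auto
    then show ?thesis by (simp add: emeasure_density)
  qed
  have eq: "emeasure ?\<mu> A = emeasure (density lborel ?f) A" if "A \<in> sets borel" "bounded A" for A
  proof (rule antisym)
    show "emeasure ?\<mu> A \<le> emeasure (density lborel ?f) A"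
      by (rule LIMSEQ_le_const[OF lim[OF that, of "- 1"]]) (use le[OF that(1)] in blast)
    show "emeasure (density lborel ?f) A \<le> emeasure ?\<mu> A"
      by (rule LIMSEQ_le_const2[OF lim[OF that, of 1]]) (use ge[OF that(1)] in blast)
  qed
  show ?thesis
  proof (rule measure_eqI)
    fix A assume "A \<in> sets ?\<mu>"
    then have A: "A \<in> sets borel" by simp
    have pieces: "emeasure ?\<mu> (A \<inter> grid 0 -` {c}) = emeasure (density lborel ?f) (A \<inter> grid 0 -` {c})" for c
      using A grid_sets bounded_grid_cell by (intro eq) auto
    note le = emeasure_le_countable_partition[where q="grid 0" and A=A, OF _ countable_range_grid]
    show "emeasure ?\<mu> A = emeasure (density lborel ?f) A"
    proof (rule antisym)
      show "emeasure ?\<mu> A \<le> emeasure (density lborel ?f) A"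
        by (rule le) (simp_all add: A grid_sets pieces)
      show "emeasure (density lborel ?f) A \<le> emeasure ?\<mu> A"
        by (rule le) (simp_all add: A grid_sets pieces)
    qed
  qed simp
qed

text \<open>The density in \<open>distr_nucleus\<close> is strictly positive everywhere, so total
  mass \<open>0\<close> would make the whole space a Lebesgue null set.\<close>

lemma prob_cell_contains_event_pos: "prob (cell_contains_event M P K) > 0"
proof (rule ccontr)
  let ?g = "\<lambda>x. l * exp (- (l * measure lborel (flower K 0 x)))"
  assume "\<not> ?thesis"
  then have "prob (cell_contains_event M P K) = 0"
    by (simp add: not_less measure_le_0_iff)
  then have "emeasure (distr (restrict_space M (cell_contains_event M P K)) borel Z) UNIV = 0"
    using emeasure_distr_nucleus[of UNIV] by (simp add: cell_contains_event_eq)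
  then have "(\<integral>\<^sup>+x. ennreal (?g x) \<partial>lborel) = 0"
    unfolding distr_nucleus using measure_flower_measurable[OF K(1)] by (simp add: emeasure_density)
  then have "AE x in (lborel :: 'a measure). ennreal (?g x) = 0"
    using measure_flower_measurable[OF K(1)] by (subst (asm) nn_integral_0_iff_AE) auto
  then have "AE x in (lborel :: 'a measure). False"
    by eventually_elim (use l_pos in auto)
  then have "(UNIV :: 'a set) \<in> null_sets lborel"
    by (subst AE_iff_null_sets) auto
  then show False
    by (simp add: null_sets_def)
qed

text \<open>Conditioning divides the law of \<open>Z\<close> on the event by its total mass, and the
  scaling by \<open>sqrt l\<close> passes into the test function.\<close>

lemma integral_conditional_law:
  fixes f :: "'a \<Rightarrow> real"
  assumes f [measurable]: "f \<in> borel_measurable borel"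
  shows "(\<integral>x. f x \<partial>conditional_law M (cell_contains_event M P K) (\<lambda>\<omega>. sqrt l *\<^sub>R Z \<omega>)) =
    (\<integral>x. l * exp (- (l * measure lborel (flower K 0 x))) * f (sqrt l *\<^sub>R x) \<partial>lborel)
      / prob (cell_contains_event M P K)"
proof -
  let ?S = "cell_contains_event M P K"
  let ?R = "restrict_space M ?S"
  note [measurable] = nucleus_measurable measure_flower_measurable[OF K(1)]
  have S: "?S \<in> sets ?R" "emeasure ?R ?S = ennreal (prob ?S)"
    using cell_contains_event_measurable by (simp_all add: sets_restrict_space_iff emeasure_restrict_space emeasure_eq_measure)
  have unif: "uniform_measure ?R ?S = density ?R (\<lambda>_. ennreal (1 / prob ?S))"
    unfolding uniform_measure_def using S prob_cell_contains_event_pos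
    by (intro density_cong) (auto simp: space_restrict_cell_event divide_ennreal[symmetric] simp del: divide_ennreal)
  have "(\<integral>x. f x \<partial>conditional_law M ?S (\<lambda>\<omega>. sqrt l *\<^sub>R Z \<omega>)) =
      (\<integral>\<omega>. f (sqrt l *\<^sub>R Z \<omega>) \<partial>density ?R (\<lambda>_. ennreal (1 / prob ?S)))"
    unfolding conditional_law_def unif by (rule integral_distr) auto
  also have "\<dots> = (\<integral>\<omega>. 1 / prob ?S * f (sqrt l *\<^sub>R Z \<omega>) \<partial>?R)"
    by (subst integral_density) auto
  also have "\<dots> = 1 / prob ?S * (\<integral>x. f (sqrt l *\<^sub>R x) \<partial>distr ?R borel Z)"
    by (subst integral_distr) auto
  also have "(\<integral>x. f (sqrt l *\<^sub>R x) \<partial>distr ?R borel Z) =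
      (\<integral>x. l * exp (- (l * measure lborel (flower K 0 x))) * f (sqrt l *\<^sub>R x) \<partial>lborel)"
    unfolding distr_nucleus using l_pos by (subst integral_density) auto
  finally show ?thesis by simp
qed

text \<open>The normalising constant is an integral of the same kind, with test function
  \<open>1\<close>, so that common factors of numerator and denominator will cancel.\<close>

lemma prob_cell_contains_event_eq:
  "prob (cell_contains_event M P K) = (\<integral>x. l * exp (- (l * measure lborel (flower K 0 x))) \<partial>lborel)"
proof -
  let ?S = "cell_contains_event M P K"
  have "prob ?S = measure (distr (restrict_space M ?S) borel Z) UNIV"
    using emeasure_distr_nucleus[of UNIV] by (simp add: cell_contains_event_eq measure_def)
  also have "\<dots> = (\<integral>x. 1 \<partial>distr (restrict_space M ?S) borel Z)"
    by simp
  also have "\<dots> = (\<integral>x. l * exp (- (l * measure lborel (flower K 0 x))) * 1 \<partial>lborel)"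
    unfolding distr_nucleus using l_pos measure_flower_measurable[OF K(1)] by (subst integral_density) auto
  finally show ?thesis by simp
qed

end

end

section \<open>Area of the flower in the plane\<close>

lemma measurable_vector2 [measurable]:
  "(\<lambda>(a, b). vector [a, b] :: real^2) \<in> borel_measurable (borel \<Otimes>\<^sub>M borel)"
proof -
  have vec: "(\<lambda>p. vector [fst p, snd p] :: real^2) = (\<lambda>p. fst p *\<^sub>R axis 1 1 + snd p *\<^sub>R axis 2 1)"
    by (auto simp: vec_eq_iff forall_2 axis_def)
  then show ?thesis
    unfolding case_prod_beta' vec by measurable
qed

text \<open>Both measures assign to a box the product of its side lengths, which characterises
  \<open>lborel\<close>. This makes iterated integrals available on \<open>real^2\<close>.\<close>

lemma lborel_real2_eq:
  "(lborel :: (real^2) measure) = distr (lborel \<Otimes>\<^sub>M lborel) borel (\<lambda>(a, b). vector [a, b])"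
proof (rule lborel_eqI)
  have meas: "(\<lambda>(a, b). vector [a, b] :: real^2) \<in> borel_measurable (lborel \<Otimes>\<^sub>M lborel)"
    using measurable_vector2 by simp
  fix a b :: "real^2"
  assume le: "\<And>i. i \<in> Basis \<Longrightarrow> a \<bullet> i \<le> b \<bullet> i"
  have le': "a $ i \<le> b $ i" for i
    using le[of "axis i 1"] by (simp add: inner_axis)
  have Basis: "Basis = {axis 1 1, axis 2 1 :: real^2}"
    by (auto simp: Basis_vec_def UNIV_2)
  have "emeasure (distr (lborel \<Otimes>\<^sub>M lborel) borel (\<lambda>(a, b). vector [a, b])) (box a b) =
      emeasure (lborel \<Otimes>\<^sub>M lborel) ({a$1<..<b$1} \<times> {a$2<..<b$2})"
    using meas
    by (subst emeasure_distr)
       (auto simp: mem_box_cart forall_2 space_pair_measure intro!: arg_cong[where f="emeasure _"])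
  also have "\<dots> = ennreal (b$1 - a$1) * ennreal (b$2 - a$2)"
    using le' by (subst lborel.emeasure_pair_measure_Times) auto
  also have "\<dots> = ennreal (\<Prod>i\<in>Basis. (b - a) \<bullet> i)"
    using le' by (simp add: Basis axis_eq_axis inner_axis ennreal_mult)
  finally show "emeasure (distr (lborel \<Otimes>\<^sub>M lborel) borel (\<lambda>(a, b). vector [a, b])) (box a b) =
      (\<Prod>i\<in>Basis. (b - a) \<bullet> i)"
    by simp
qed simp

lemma nn_integral_real2:
  assumes [measurable]: "f \<in> borel_measurable borel"
  shows "(\<integral>\<^sup>+z. f (z :: real^2) \<partial>lborel) = (\<integral>\<^sup>+a. \<integral>\<^sup>+b. f (vector [a, b]) \<partial>lborel \<partial>lborel)"
proof -
  have meas: "(\<lambda>(a, b). vector [a, b] :: real^2) \<in> borel_measurable (lborel \<Otimes>\<^sub>M lborel)"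
    using measurable_vector2 by simp
  have "(\<integral>\<^sup>+z. f z \<partial>lborel) = (\<integral>\<^sup>+p. f (case p of (a, b) \<Rightarrow> vector [a, b]) \<partial>(lborel \<Otimes>\<^sub>M lborel))"
    by (subst lborel_real2_eq) (rule nn_integral_distr[OF meas], simp)
  also have "\<dots> = (\<integral>\<^sup>+a. \<integral>\<^sup>+b. f (vector [a, b]) \<partial>lborel \<partial>lborel)"
    using measurable_compose[OF meas assms]
    by (subst lborel.nn_integral_fst[symmetric]) auto
  finally show ?thesis .
qed

lemma inner_unit_dir: "z \<bullet> unit_dir t = z $ 1 * cos t + z $ 2 * sin t"
  by (simp add: inner_vec_def sum_2 unit_dir_def)

lemma norm_unit_dir [simp]: "norm (unit_dir t) = 1"
  by (simp add: norm_eq_sqrt_inner inner_vec_def sum_2 unit_dir_def power2_eq_square[symmetric])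

lemma unit_dir_eq: "unit_dir t = cos t *\<^sub>R axis 1 1 + sin t *\<^sub>R axis 2 1"
  by (simp add: vec_eq_iff forall_2 axis_def unit_dir_def)

lemma continuous_on_unit_dir [continuous_intros]:
  fixes A :: "'a::t2_space set"
  shows "continuous_on A f \<Longrightarrow> continuous_on A (\<lambda>x. unit_dir (f x))"
  unfolding unit_dir_eq by (intro continuous_intros continuous_on_cos continuous_on_sin)

text \<open>The map \<open>(t, s) \<mapsto> sqrt (2 * s) *\<^sub>R unit_dir t\<close> preserves area.\<close>

lemma measure_polar_region:
  fixes \<rho> :: "real \<Rightarrow> real"
  assumes cont: "continuous_on UNIV \<rho>" and nonneg: "\<And>t. 0 \<le> \<rho> t"
  defines "T \<equiv> {sqrt (2 * s) *\<^sub>R unit_dir t | s t. 0 < t \<and> t < 2 * pi \<and> 0 < s \<and> s < \<rho> t}"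
  shows "measure lebesgue T = integral {0..2*pi} \<rho>" and "T \<in> lmeasurable"
proof -
  \<comment> \<open>The first coordinate is the angle, the second is half the squared radius;
    \<open>G\<close> is the passage to Cartesian coordinates and \<open>G'\<close> its
    derivative.\<close>
  define S :: "(real^2) set" where "S = {q. 0 < q$1 \<and> q$1 < 2*pi \<and> 0 < q$2 \<and> q$2 < \<rho> (q$1)}"
  define G :: "real^2 \<Rightarrow> real^2" where
    "G = (\<lambda>q. (sqrt (2 * q$2) * cos (q$1)) *\<^sub>R axis 1 1 + (sqrt (2 * q$2) * sin (q$1)) *\<^sub>R axis 2 1)"
  define G' :: "real^2 \<Rightarrow> real^2 \<Rightarrow> real^2" where
    "G' = (\<lambda>q h.
      (sqrt (2 * q$2) * (h$1 * - sin (q$1)) + 2 * h$2 * (inverse (sqrt (2 * q$2)) / 2) * cos (q$1)) *\<^sub>R axis 1 1 +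
      (sqrt (2 * q$2) * (h$1 * cos (q$1)) + 2 * h$2 * (inverse (sqrt (2 * q$2)) / 2) * sin (q$1)) *\<^sub>R axis 2 1)"
  have der1: "((\<lambda>q::real^2. q $ i) has_derivative (\<lambda>h. h $ i)) F" for i F
    by (rule bounded_linear_imp_has_derivative[OF bounded_linear_vec_nth])
  have der: "(G has_derivative G' q) (at q within S)" if "q \<in> S" for q
  proof -
    have q: "q $ 2 > 0" using that by (simp add: S_def)
    have dr: "((\<lambda>q::real^2. sqrt (2 * q$2)) has_derivative
        (\<lambda>h. 2 * h$2 * (inverse (sqrt (2 * q$2)) / 2))) (at q within S)"
      using q by (intro DERIV_compose_FDERIV DERIV_real_sqrt has_derivative_mult_right der1) simp
    note dc = DERIV_compose_FDERIV[OF DERIV_cos der1[of 1 "at q within S"]]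
    note ds = DERIV_compose_FDERIV[OF DERIV_sin der1[of 1 "at q within S"]]
    show ?thesis
      unfolding G_def G'_def
      by (intro has_derivative_add has_derivative_scaleR_left has_derivative_mult[OF dr] dc ds)
  qed
  have G_eq: "G q = sqrt (2 * q$2) *\<^sub>R unit_dir (q$1)" for q
    by (simp add: G_def unit_dir_eq scaleR_add_right)
  have inj: "inj_on G S"
  proof (rule inj_onI)
    fix q q' assume q: "q \<in> S" "q' \<in> S" and eq: "G q = G q'"
    then have pos: "q $ 2 > 0" "q' $ 2 > 0" by (auto simp: S_def)
    have "norm (G q) = norm (G q')" using eq by simp
    then have 2: "q $ 2 = q' $ 2" using pos by (simp add: G_eq)
    with eq pos have "unit_dir (q$1) = unit_dir (q'$1)" by (simp add: G_eq)
    then have "sin (q$1) = sin (q'$1) \<and> cos (q$1) = cos (q'$1)"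
      by (simp add: unit_dir_def vec_eq_iff forall_2)
    then obtain n :: int where n: "q$1 = q'$1 + 2 * pi * n" unfolding sin_cos_eq_iff by blast
    \<comment> \<open>Both angles lie in an open interval of length \<open>2 * pi\<close>, so their
      difference is a multiple of \<open>2 * pi\<close> only if it is zero.\<close>
    have "\<bar>2 * pi * n\<bar> < 2 * pi * 1" using n q by (auto simp: S_def)
    then have "\<bar>real_of_int n\<bar> < 1" by (simp add: abs_mult)
    then have "n = 0" by linarith
    with n 2 show "q = q'" by (simp add: vec_eq_iff forall_2)
  qed
  \<comment> \<open>The derivative in the angle contributes the factor
    \<open>sqrt (2 * q $ 2)\<close> and the derivative in the other variable its inverse, so the
    determinant is \<open>- 1\<close>.\<close>
  have det: "\<bar>det (matrix (G' q))\<bar> = 1" if "q \<in> S" for q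
  proof -
    define a where "a = sqrt (2 * q $ 2)"
    have a: "a * inverse a = 1" using that by (simp add: a_def S_def)
    have "det (matrix (G' q)) = - (a * inverse a) * ((sin (q$1))\<^sup>2 + (cos (q$1))\<^sup>2)"
      unfolding det_2 matrix_def G'_def a_def[symmetric]
      by (simp add: axis_def power2_eq_square distrib_left)
    then show ?thesis unfolding a by simp
  qed
  have open_S: "open S"
  proof -
    have "continuous_on UNIV (\<lambda>q::real^2. \<rho> (q $ 1))"
      by (rule continuous_on_compose2[OF cont]) (auto intro!: continuous_intros)
    then show ?thesis
      unfolding S_def by (intro open_Collect_conj open_Collect_less continuous_intros)
  qed
  have int\<rho>: "(\<rho> has_integral integral {0..2*pi} \<rho>) {0..2*pi}"
    by (intro integrable_integral integrable_continuous_interval continuous_on_subset[OF cont]) simp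
  have "emeasure lborel S = (\<integral>\<^sup>+a. \<integral>\<^sup>+b. indicator S (vector [a, b]) \<partial>lborel \<partial>lborel)"
    using open_S by (subst nn_integral_real2[symmetric]) auto
  also have "\<dots> = (\<integral>\<^sup>+a. ennreal (\<rho> a) * indicator {0<..<2*pi} a \<partial>lborel)"
  proof (rule nn_integral_cong)
    fix a :: real
    have "(\<lambda>b. indicator S (vector [a, b]) :: ennreal) = (\<lambda>b. indicator {0<..<2*pi} a * indicator {0<..<\<rho> a} b)"
      by (rule ext) (simp add: S_def indicator_def)
    moreover have "(\<integral>\<^sup>+b. indicator {0<..<2*pi} a * indicator {0<..<\<rho> a} b \<partial>lborel) =
        indicator {0<..<2*pi} a * ennreal (\<rho> a)"
      using nonneg[of a] by (subst nn_integral_cmult_indicator) auto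
    ultimately show "(\<integral>\<^sup>+b. indicator S (vector [a, b]) \<partial>lborel) = ennreal (\<rho> a) * indicator {0<..<2*pi} a"
      by (simp only: mult.commute)
  qed
  also have "\<dots> = (\<integral>\<^sup>+a. ennreal (\<rho> a) * indicator {0..2*pi} a \<partial>lborel)"
  proof (rule nn_integral_cong_AE)
    have "AE a in lborel. a \<noteq> 0 \<and> a \<noteq> 2 * pi"
      by (intro AE_conjI AE_lborel_singleton)
    then show "AE a in lborel. ennreal (\<rho> a) * indicator {0<..<2*pi} a = ennreal (\<rho> a) * indicator {0..2*pi} a"
      by eventually_elim (auto split: split_indicator)
  qed
  also have "\<dots> = ennreal (integral {0..2*pi} \<rho>)"
    by (rule nn_integral_has_integral_lebesgue'[OF nonneg int\<rho>])
  finally have em: "emeasure lborel S = ennreal (integral {0..2*pi} \<rho>)" .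
  have S_leb: "S \<in> lmeasurable"
    using open_S em by (intro fmeasurableI) auto
  have T: "T = G ` S"
    unfolding T_def S_def G_eq image_def
  proof (intro Collect_cong iffI)
    fix z assume "\<exists>s t. z = sqrt (2 * s) *\<^sub>R unit_dir t \<and> 0 < t \<and> t < 2 * pi \<and> 0 < s \<and> s < \<rho> t"
    then obtain s t where "z = sqrt (2 * s) *\<^sub>R unit_dir t" "0 < t" "t < 2 * pi" "0 < s" "s < \<rho> t" by blast
    then show "\<exists>x\<in>{q::real^2. 0 < q $ 1 \<and> q $ 1 < 2 * pi \<and> 0 < q $ 2 \<and> q $ 2 < \<rho> (q $ 1)}. z = sqrt (2 * x $ 2) *\<^sub>R unit_dir (x $ 1)"
      by (intro bexI[of _ "vector [t, s]"]) auto
  qed auto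
  have int1: "(\<lambda>q. \<bar>det (matrix (G' q))\<bar>) integrable_on S"
    using S_leb integrable_cong[of S "\<lambda>q. \<bar>det (matrix (G' q))\<bar>" "\<lambda>_. 1 :: real"] det
    by (simp add: integrable_on_const)
  have "measure lebesgue T = integral S (\<lambda>q. \<bar>det (matrix (G' q))\<bar>)"
    unfolding T using S_leb by (intro measure_differentiable_image_eq der inj int1) auto
  also have "\<dots> = integral S (\<lambda>q. 1)"
    by (intro integral_cong det)
  also have "\<dots> = measure lebesgue S"
    using S_leb by (simp add: lmeasure_integral)
  also have "\<dots> = integral {0..2*pi} \<rho>"
    using em open_S integral_nonneg[OF has_integral_integrable[OF int\<rho>]] nonneg by (simp add: measure_def)
  finally show "measure lebesgue T = integral {0..2*pi} \<rho>" .
  show "T \<in> lmeasurable"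
    unfolding T using S_leb
    by (intro measurable_differentiable_image_eq[OF _ der inj, THEN iffD2, OF _ _ int1]) auto
qed

section \<open>The support function and the area of the flower\<close>

lemma support_fun_periodic: "support_fun K (t + 2 * pi) = support_fun K t"
  by (simp add: support_fun_def unit_dir_def)

context
  fixes K :: "(real^2) set"
  assumes K: "compact K" "K \<noteq> {}"
begin

lemma support_fun_attained:
  obtains y where "y \<in> K" "support_fun K t = y \<bullet> unit_dir t"
    "\<And>y'. y' \<in> K \<Longrightarrow> y' \<bullet> unit_dir t \<le> support_fun K t"
proof -
  have "\<exists>y\<in>K. \<forall>y'\<in>K. y' \<bullet> unit_dir t \<le> y \<bullet> unit_dir t"
    by (intro continuous_attains_sup K continuous_intros)
  then obtain y where y: "y \<in> K" "\<And>y'. y' \<in> K \<Longrightarrow> y' \<bullet> unit_dir t \<le> y \<bullet> unit_dir t" by blast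
  have "support_fun K t = y \<bullet> unit_dir t"
    unfolding support_fun_def using y by (intro cSup_eq_maximum) auto
  with y that show ?thesis by simp
qed

lemma inner_le_support_fun: "y \<in> K \<Longrightarrow> y \<bullet> unit_dir t \<le> support_fun K t"
  using support_fun_attained[of t] by metis

text \<open>The maximiser for one direction, tested in another, loses at most \<open>b\<close> times
  the distance of the two directions, where \<open>b\<close> bounds the norms in
  \<open>K\<close>.\<close>

lemma continuous_support_fun: "continuous_on UNIV (support_fun K)"
proof -
  obtain b where b: "\<And>y. y \<in> K \<Longrightarrow> norm y \<le> b"
    using compact_imp_bounded[OF K(1)] by (auto simp: bounded_iff)
  have le: "support_fun K t \<le> support_fun K s + b * norm (unit_dir t - unit_dir s)" for s t
  proof -
    obtain y where y: "y \<in> K" "support_fun K t = y \<bullet> unit_dir t" by (rule support_fun_attained)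
    have "y \<bullet> unit_dir t = y \<bullet> unit_dir s + y \<bullet> (unit_dir t - unit_dir s)"
      by (simp add: inner_diff_right)
    also have "y \<bullet> (unit_dir t - unit_dir s) \<le> norm y * norm (unit_dir t - unit_dir s)"
      by (rule norm_cauchy_schwarz)
    also have "\<dots> \<le> b * norm (unit_dir t - unit_dir s)"
      by (intro mult_right_mono b y) auto
    finally show ?thesis using y inner_le_support_fun[OF y(1), of s] by simp
  qed
  have "(support_fun K \<longlongrightarrow> support_fun K s) (at s)" for s
  proof (rule LIM_zero_cancel, rule Lim_null_comparison)
    show "\<forall>\<^sub>F t in at s. norm (support_fun K t - support_fun K s) \<le> b * norm (unit_dir t - unit_dir s)"
      using le[of _ s] le[of s] by (intro always_eventually) (auto simp: abs_le_iff norm_minus_commute algebra_simps)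
    have "continuous_on UNIV unit_dir"
      by (intro continuous_intros)
    then have "(unit_dir \<longlongrightarrow> unit_dir s) (at s)"
      by (simp add: continuous_on_eq_continuous_at isCont_def)
    then have "((\<lambda>t. b * norm (unit_dir t - unit_dir s)) \<longlongrightarrow> b * norm (unit_dir s - unit_dir s)) (at s)"
      by (intro tendsto_intros)
    then show "((\<lambda>t. b * norm (unit_dir t - unit_dir s)) \<longlongrightarrow> 0) (at s)" by simp
  qed
  then show ?thesis
    by (simp add: continuous_on_eq_continuous_at isCont_def)
qed

text \<open>The disc around \<open>y\<close> with \<open>x\<close> on its boundary meets the ray
  from \<open>x\<close> in direction \<open>unit_dir t\<close> in a chord of length
  \<open>2 * ((y - x) \<bullet> unit_dir t)\<close>, if this is positive. Maximising over
  \<open>y\<close> gives the radial extent of the flower, and half its square is the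
  integrand.\<close>

lemma measure_flower_eq:
  "measure lborel (flower K 0 x) =
    integral {0..2*pi} (\<lambda>t. 2 * (max 0 (support_fun K t - x \<bullet> unit_dir t))\<^sup>2)"
proof -
  define h where "h = (\<lambda>t. support_fun K t - x \<bullet> unit_dir t)"
  define \<rho> where "\<rho> = (\<lambda>t. 2 * (max 0 (h t))\<^sup>2)"
  define T where "T = {sqrt (2 * s) *\<^sub>R unit_dir t | s t. 0 < t \<and> t < 2 * pi \<and> 0 < s \<and> s < \<rho> t}"
  have "continuous_on UNIV \<rho>"
    unfolding \<rho>_def h_def by (intro continuous_intros continuous_support_fun)
  then have T: "measure lebesgue T = integral {0..2*pi} \<rho>" "T \<in> lmeasurable"
    unfolding T_def by (rule measure_polar_region, simp add: \<rho>_def)+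
  have mem: "x + r *\<^sub>R unit_dir t \<in> flower K 0 x \<longleftrightarrow> r < 2 * h t" if "r > 0" for r t
  proof -
    have "norm (x + r *\<^sub>R unit_dir t - y) < norm (x - y) \<longleftrightarrow> r < 2 * ((y - x) \<bullet> unit_dir t)" for y
    proof -
      define w where "w = r *\<^sub>R unit_dir t"
      have "(x + w - y) \<bullet> (x + w - y) = (x - y) \<bullet> (x - y) + (w \<bullet> w - 2 * (w \<bullet> (y - x)))"
        by (simp add: inner_diff_left inner_diff_right inner_add_left inner_add_right inner_commute algebra_simps)
      moreover have "w \<bullet> w - 2 * (w \<bullet> (y - x)) = r * (r - 2 * ((y - x) \<bullet> unit_dir t))"
        by (simp add: w_def dot_square_norm inner_commute power2_eq_square algebra_simps)
      ultimately show ?thesis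
        unfolding norm_lt w_def[symmetric] using that by (simp add: mult_less_0_iff)
    qed
    then have "x + r *\<^sub>R unit_dir t \<in> flower K 0 x \<longleftrightarrow> (\<exists>y\<in>K. r < 2 * (y \<bullet> unit_dir t - x \<bullet> unit_dir t))"
      by (simp add: flower_def inner_diff_left)
    also have "\<dots> \<longleftrightarrow> r < 2 * h t"
    proof
      assume "\<exists>y\<in>K. r < 2 * (y \<bullet> unit_dir t - x \<bullet> unit_dir t)"
      then obtain y where "y \<in> K" "r < 2 * (y \<bullet> unit_dir t - x \<bullet> unit_dir t)" by blast
      then show "r < 2 * h t" using inner_le_support_fun[of y t] by (simp add: h_def)
    next
      assume "r < 2 * h t"
      moreover obtain y where "y \<in> K" "support_fun K t = y \<bullet> unit_dir t"
        by (rule support_fun_attained)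
      ultimately show "\<exists>y\<in>K. r < 2 * (y \<bullet> unit_dir t - x \<bullet> unit_dir t)"
        by (auto simp: h_def)
    qed
    finally show ?thesis .
  qed
  have less: "s < \<rho> t \<longleftrightarrow> sqrt (2 * s) < 2 * h t" if "s > 0" for s t
  proof (cases "h t > 0")
    case True
    have "s < \<rho> t \<longleftrightarrow> (sqrt (2 * s))\<^sup>2 < (2 * h t)\<^sup>2"
      using that True by (simp add: \<rho>_def power_mult_distrib)
    also have "\<dots> \<longleftrightarrow> sqrt (2 * s) < 2 * h t"
      using that True power_strict_mono[of "sqrt (2 * s)" "2 * h t" 2]
        power2_less_imp_less[of "sqrt (2 * s)" "2 * h t"] by auto
    finally show ?thesis .
  next
    case False
    then have "\<rho> t = 0" "2 * h t \<le> 0" by (simp_all add: \<rho>_def)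
    moreover have "sqrt (2 * s) > 0" using that by simp
    ultimately show ?thesis using that by linarith
  qed
  define F where "F = (\<lambda>z. z - x) ` flower K 0 x"
  have F_iff: "z \<in> F \<longleftrightarrow> x + z \<in> flower K 0 x" for z
    by (force simp: F_def image_iff)
  have "T \<subseteq> F"
  proof
    fix z assume "z \<in> T"
    then obtain s t where z: "z = sqrt (2 * s) *\<^sub>R unit_dir t" "0 < s" "s < \<rho> t"
      by (auto simp: T_def)
    then show "z \<in> F" using mem[of "sqrt (2 * s)" t] less[of s t] by (simp add: F_iff)
  qed
  \<comment> \<open>The polar region omits the angle \<open>0\<close>, so what it misses of the
    translated flower lies on the first coordinate axis, a null set.\<close>
  moreover have "F - T \<subseteq> {z. axis 2 1 \<bullet> z = 0}"
  proof
    fix z assume z: "z \<in> F - T"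
    then have "z \<noteq> 0" using nucleus_notin_flower[of x K] by (auto simp: F_iff)
    define r where "r = norm z"
    have r: "r > 0" using \<open>z \<noteq> 0\<close> by (simp add: r_def)
    have "(z$1 / r)\<^sup>2 + (z$2 / r)\<^sup>2 = ((z$1)\<^sup>2 + (z$2)\<^sup>2) / r\<^sup>2"
      by (simp add: power_divide add_divide_distrib)
    also have "(z$1)\<^sup>2 + (z$2)\<^sup>2 = r\<^sup>2"
      unfolding r_def power2_norm_eq_inner by (simp add: inner_vec_def sum_2 power2_eq_square)
    finally have "(z$1 / r)\<^sup>2 + (z$2 / r)\<^sup>2 = 1" using r by simp
    then obtain t where t: "0 \<le> t" "t < 2*pi" "z$1 / r = cos t" "z$2 / r = sin t"
      by (rule sincos_total_2pi)
    have zr: "z = r *\<^sub>R unit_dir t"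
      using t(3,4) r by (simp add: vec_eq_iff forall_2 unit_dir_def field_simps)
    show "z \<in> {z. axis 2 1 \<bullet> z = 0}"
    proof (cases "t = 0")
      case True
      then show ?thesis using t(4) r by (simp add: inner_axis')
    next
      case False
      have rs: "sqrt (2 * (r\<^sup>2 / 2)) = r" "r\<^sup>2 / 2 > 0" using r by auto
      have "r < 2 * h t" using z mem[OF r, of t] by (simp add: F_iff zr)
      then have "r\<^sup>2 / 2 < \<rho> t" using less[OF rs(2), of t] unfolding rs(1) by simp
      then have "z \<in> T"
        unfolding T_def using False t rs zr by (intro CollectI exI[of _ "r\<^sup>2 / 2"] exI[of _ t]) auto
      with z show ?thesis by blast
    qed
  qed
  ultimately have "negligible (T - F \<union> (F - T))"
    using negligible_hyperplane[of "axis 2 1 :: real^2" 0] negligible_subset[of _ "F - T"]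
    by (auto simp: axis_eq_0_iff Diff_eq_empty_iff[THEN iffD2])
  then have "measure lebesgue F = measure lebesgue T"
    by (rule measure_negligible_symdiff[OF T(2)])
  moreover have "measure lebesgue F = measure lborel (flower K 0 x)"
    unfolding F_def measure_translation_subtract by simp
  ultimately show ?thesis
    using T(1) by (simp add: \<rho>_def h_def)
qed

end

section \<open>Trigonometric integrals and the Steiner point\<close>

text \<open>By periodicity an antiderivative \<open>G\<close> has the same increment over all
  intervals of length \<open>2 * pi\<close>, and both integrals are such increments.\<close>

lemma integral_periodic_reflect:
  fixes g :: "real \<Rightarrow> real"
  assumes cont: "continuous_on UNIV g" and per: "\<And>t. g (t + 2 * pi) = g t"
  shows "integral {0..2*pi} (\<lambda>t. g (c - t)) = integral {0..2*pi} g"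
proof -
  have "\<exists>G. \<forall>t::real. (-\<infinity>) < ereal t \<longrightarrow> ereal t < \<infinity> \<longrightarrow> (G has_vector_derivative g t) (at t)"
    using cont by (intro einterval_antiderivative) (auto simp: continuous_on_eq_continuous_at)
  then obtain G where G: "\<And>t. (G has_real_derivative g t) (at t)"
    by (auto simp: has_real_derivative_iff_has_vector_derivative)
  have D: "((\<lambda>t. G (t + 2 * pi) - G t) has_real_derivative 0) (at t)" for t
  proof -
    have "((\<lambda>t. G (t + 2 * pi)) has_real_derivative g (t + 2 * pi) * 1) (at t)"
      by (rule DERIV_chain2[OF G]) (auto intro!: derivative_eq_intros)
    from DERIV_diff[OF this G[of t]] show ?thesis by (simp add: per)
  qed
  have const: "G (s + 2 * pi) - G s = G (t + 2 * pi) - G t" for s t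
    using DERIV_isconst_all[of "\<lambda>t. G (t + 2 * pi) - G t" s t] D by blast
  have "((\<lambda>t. g (c - t)) has_integral - G (c - 2 * pi) - - G (c - 0)) {0..2*pi}"
  proof (rule fundamental_theorem_of_calculus)
    fix t
    have "((\<lambda>t. G (c - t)) has_real_derivative g (c - t) * -1) (at t)"
      by (rule DERIV_chain2[OF G]) (auto intro!: derivative_eq_intros)
    then have "((\<lambda>t. - G (c - t)) has_real_derivative g (c - t)) (at t)"
      using DERIV_minus by fastforce
    then show "((\<lambda>t. - G (c - t)) has_vector_derivative g (c - t)) (at t within {0..2*pi})"
      by (simp add: has_real_derivative_iff_has_vector_derivative has_vector_derivative_at_within)
  qed simp
  moreover have "(g has_integral G (2 * pi) - G 0) {0..2*pi}"
    using G by (intro fundamental_theorem_of_calculus)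
      (auto simp: has_real_derivative_iff_has_vector_derivative has_vector_derivative_at_within)
  moreover have "- G (c - 2 * pi) - - G (c - 0) = G (2 * pi) - G 0"
    using const[of "c - 2 * pi" 0] by simp
  ultimately show ?thesis
    by (simp add: integral_unique)
qed

text \<open>This supplies the quadratic term of the area and hence, in the end, the variance of the
  limit. \<open>H\<close> is an explicit antiderivative.\<close>

lemma integral_inner_unit_dir_square:
  "((\<lambda>t. (x \<bullet> unit_dir t)\<^sup>2) has_integral pi * (norm x)\<^sup>2) {0..2*pi}"
proof -
  define a b where "a = x $ 1" and "b = x $ 2"
  define H where "H = (\<lambda>t. a\<^sup>2 * ((t + sin t * cos t) / 2) + a * b * (sin t)\<^sup>2 + b\<^sup>2 * ((t - sin t * cos t) / 2))"
  have "(H has_real_derivative (a * cos t + b * sin t)\<^sup>2) (at t)" for t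
  proof -
    have "(H has_real_derivative a\<^sup>2 * ((1 + (cos t * cos t - sin t * sin t)) / 2) + a * b * (2 * sin t * cos t)
        + b\<^sup>2 * ((1 - (cos t * cos t - sin t * sin t)) / 2)) (at t)"
      unfolding H_def by (auto intro!: derivative_eq_intros simp: power2_eq_square)
    moreover have "1 + (cos t * cos t - sin t * sin t) = 2 * (cos t)\<^sup>2"
      "1 - (cos t * cos t - sin t * sin t) = 2 * (sin t)\<^sup>2"
      using sin_cos_squared_add[of t] by (simp_all add: power2_eq_square)
    ultimately have "(H has_real_derivative a\<^sup>2 * ((2 * (cos t)\<^sup>2) / 2) + a * b * (2 * sin t * cos t)
        + b\<^sup>2 * ((2 * (sin t)\<^sup>2) / 2)) (at t)" by simp
    then show ?thesis by (simp add: power2_eq_square algebra_simps)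
  qed
  then have "((\<lambda>t. (a * cos t + b * sin t)\<^sup>2) has_integral H (2*pi) - H 0) {0..2*pi}"
    by (intro fundamental_theorem_of_calculus)
      (auto simp: has_real_derivative_iff_has_vector_derivative has_vector_derivative_at_within)
  moreover have "H (2*pi) - H 0 = pi * (a\<^sup>2 + b\<^sup>2)"
    by (simp add: H_def algebra_simps)
  moreover have "(norm x)\<^sup>2 = a\<^sup>2 + b\<^sup>2"
    unfolding power2_norm_eq_inner
    by (simp add: a_def b_def inner_vec_def sum_2 power2_eq_square)
  ultimately show ?thesis
    by (simp add: inner_unit_dir a_def b_def)
qed

context
  fixes K :: "(real^2) set"
  assumes K: "compact K" "interior K \<noteq> {}" and steiner: "steiner_point K = 0"
begin

lemma K_nonempty: "K \<noteq> {}"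
  using K(2) by auto

text \<open>The vector integral in \<open>steiner_point\<close> is paired with \<open>v\<close>.
  This removes the linear term of the area and drives the positivity argument for the support
  function.\<close>

lemma integral_support_fun_inner:
  "((\<lambda>t. support_fun K t * (v \<bullet> unit_dir t)) has_integral 0) {0..2*pi}"
proof -
  have "(\<lambda>t. support_fun K t *\<^sub>R unit_dir t) integrable_on {0..2*pi}"
    by (intro integrable_continuous_interval continuous_intros
        continuous_on_subset[OF continuous_support_fun[OF K(1) K_nonempty]]) auto
  moreover have "integral {0..2*pi} (\<lambda>t. support_fun K t *\<^sub>R unit_dir t) = 0"
    using steiner by (simp add: steiner_point_def)
  ultimately have "((\<lambda>t. support_fun K t *\<^sub>R unit_dir t) has_integral 0) {0..2*pi}"
    by (metis integrable_integral)
  from has_integral_linear[OF this bounded_linear_inner_right[of v]]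
  show ?thesis by (simp add: o_def)
qed

text \<open>A nonpositive width would confine \<open>K\<close> to a line, contradicting its nonempty
  interior.\<close>

lemma support_fun_width: "support_fun K t + support_fun K (t + pi) > 0"
proof (rule ccontr)
  assume "\<not> ?thesis"
  then have le: "support_fun K t + support_fun K (t + pi) \<le> 0" by simp
  have "K \<subseteq> {y. unit_dir t \<bullet> y = support_fun K t}"
  proof
    fix y assume "y \<in> K"
    then have "y \<bullet> unit_dir t \<le> support_fun K t" "y \<bullet> unit_dir (t + pi) \<le> support_fun K (t + pi)"
      by (simp_all add: inner_le_support_fun[OF K(1) K_nonempty])
    moreover have "y \<bullet> unit_dir (t + pi) = - (y \<bullet> unit_dir t)"
      by (simp add: inner_unit_dir)
    ultimately show "y \<in> {y. unit_dir t \<bullet> y = support_fun K t}"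
      using le by (simp add: inner_commute)
  qed
  then have "interior K \<subseteq> interior {y. unit_dir t \<bullet> y = support_fun K t}"
    by (rule interior_mono)
  also have "\<dots> = {}"
    using norm_unit_dir[of t] by (intro interior_hyperplane) (metis norm_zero zero_neq_one)
  finally show False using K(2) by simp
qed

text \<open>If \<open>support_fun K a \<le> 0\<close>, then reflecting directions in the line orthogonal to \<open>unit_dir a\<close>
  shows that the integral of \<open>support_fun K t * cos (t - a)\<close> is negative, whereas it vanishes
  because the Steiner point is \<open>0\<close>.\<close>

lemma support_fun_pos:
  assumes a: "a \<in> {0..2*pi}"
  shows "support_fun K a > 0"
proof (rule ccontr)
  assume "\<not> ?thesis"
  then have pa: "support_fun K a \<le> 0" by simp
  let ?p = "support_fun K"
  note cont = continuous_support_fun[OF K(1) K_nonempty]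
  define g where "g = (\<lambda>t. ?p t * cos (t - a))"
  \<comment> \<open>The reflection in the line orthogonal to \<open>unit_dir a\<close> sends the
    direction with angle \<open>t\<close> to the one with angle \<open>c - t\<close>.\<close>
  define c where "c = 2 * a + pi"
  have g_refl: "g (c - t) = - (?p (c - t) * cos (t - a))" for t
  proof -
    have "c - t - a = pi - (t - a)" by (simp add: c_def)
    then have "cos (c - t - a) = - cos (t - a)"
      using cos_diff[of pi "t - a"] by (simp only:) simp
    then show ?thesis unfolding g_def by simp
  qed
  have cont_g: "continuous_on UNIV g"
    unfolding g_def by (intro continuous_intros cont)
  have inner_a: "unit_dir a \<bullet> unit_dir t = cos (t - a)" for t
    by (simp add: inner_unit_dir cos_diff) (simp add: unit_dir_def)
  have "(g has_integral 0) {0..2*pi}"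
    using integral_support_fun_inner[of "unit_dir a"] unfolding inner_a g_def .
  moreover have "integral {0..2*pi} (\<lambda>t. g (c - t)) = integral {0..2*pi} g"
  proof (rule integral_periodic_reflect[OF cont_g])
    fix t
    have "cos (t + 2 * pi - a) = cos (t - a)"
      using cos_periodic[of "t - a"] by (simp add: algebra_simps)
    then show "g (t + 2 * pi) = g t"
      by (simp add: g_def support_fun_periodic)
  qed
  moreover have cont_r: "continuous_on UNIV (\<lambda>t. g (c - t))"
    by (rule continuous_on_compose2[OF cont_g]) (auto intro!: continuous_intros)
  have "(\<lambda>t. g (c - t)) integrable_on {0..2*pi}"
    by (intro integrable_continuous_interval continuous_on_subset[OF cont_r]) simp
  ultimately have "((\<lambda>t. g (c - t)) has_integral 0) {0..2*pi}"
    by (metis integrable_integral integral_unique)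
  with \<open>(g has_integral 0) {0..2*pi}\<close> have int: "((\<lambda>t. - (g t + g (c - t))) has_integral 0) {0..2*pi}"
    using has_integral_neg[OF has_integral_add, of g 0 _ "\<lambda>t. g (c - t)" 0] by simp
  have nonneg: "0 \<le> - (g t + g (c - t))" for t
  proof -
    \<comment> \<open>Subtracting the reflected direction leaves \<open>2 * cos (t - a)\<close>
      times \<open>unit_dir a\<close>, whose inner product with points of \<open>K\<close> is
      nonpositive. So the sign of the cosine decides which of the two support values is the
      larger.\<close>
    have refl: "y \<bullet> unit_dir t = y \<bullet> unit_dir (c - t) + 2 * cos (t - a) * (y \<bullet> unit_dir a)" for y
    proof -
      define s where "s = t - a"
      have t: "t = s + a" and ct: "c - t = pi + (a - s)" by (simp_all add: s_def c_def)
      have "cos (c - t) = - cos (a - s)" "sin (c - t) = - sin (a - s)"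
        unfolding ct cos_add sin_add by simp_all
      moreover have "cos t = cos s * cos a - sin s * sin a" "sin t = sin s * cos a + cos s * sin a"
        unfolding t by (rule cos_add, rule sin_add)
      ultimately have 1: "cos t = cos (c - t) + 2 * cos s * cos a"
        and 2: "sin t = sin (c - t) + 2 * cos s * sin a"
        by (simp_all add: cos_diff sin_diff)
      show ?thesis
        unfolding inner_unit_dir s_def[symmetric] 1 2 by (simp add: distrib_left distrib_right)
    qed
    have ya: "y \<bullet> unit_dir a \<le> 0" if "y \<in> K" for y
      using inner_le_support_fun[OF K(1) K_nonempty that, of a] pa by simp
    have "(?p t - ?p (c - t)) * cos (t - a) \<le> 0"
    proof (cases "cos (t - a) \<ge> 0")
      case True
      obtain y where y: "y \<in> K" "?p t = y \<bullet> unit_dir t"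
        by (rule support_fun_attained[OF K(1) K_nonempty])
      have "2 * cos (t - a) * (y \<bullet> unit_dir a) \<le> 0"
        using True ya[OF y(1)] by (simp add: mult_nonneg_nonpos)
      then have "?p t \<le> ?p (c - t)"
        using y refl[of y] inner_le_support_fun[OF K(1) K_nonempty y(1), of "c - t"] by linarith
      with True show ?thesis by (simp add: mult_nonpos_nonneg)
    next
      case False
      obtain y where y: "y \<in> K" "?p (c - t) = y \<bullet> unit_dir (c - t)"
        by (rule support_fun_attained[OF K(1) K_nonempty])
      have "2 * cos (t - a) * (y \<bullet> unit_dir a) \<ge> 0"
        using False ya[OF y(1)] by (simp add: mult_nonpos_nonpos)
      then have "?p (c - t) \<le> ?p t"
        using y refl[of y] inner_le_support_fun[OF K(1) K_nonempty y(1), of t] by linarith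
      with False show ?thesis by (simp add: mult_nonneg_nonpos)
    qed
    moreover have "- (g t + g (c - t)) = - ((?p t - ?p (c - t)) * cos (t - a))"
      unfolding g_refl unfolding g_def left_diff_distrib by linarith
    ultimately show ?thesis by linarith
  qed
  \<comment> \<open>A continuous nonnegative function with integral \<open>0\<close> vanishes. At
    \<open>t = a\<close> this makes the support values in two opposite directions equal, hence both
    nonpositive, against the positive width.\<close>
  have "continuous_on {0..2*pi} (\<lambda>t. - (g t + g (c - t)))"
    by (intro continuous_intros continuous_on_subset[OF cont_g] continuous_on_subset[OF cont_r]) auto
  then have "- (g a + g (c - a)) = 0"
    using integral_eq_0_iff[of 0 "2 * pi" "\<lambda>t. - (g t + g (c - t))"] nonneg integral_unique[OF int] a
    by auto
  then have "?p a = ?p (c - a)"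
    unfolding g_refl by (simp add: g_def)
  then have "?p a = ?p (a + pi)" by (simp add: c_def)
  then show False using support_fun_width[of a] pa by simp
qed

text \<open>\<open>r\<close> is a positive lower bound of the support function, which exists by
  compactness. For \<open>norm x \<le> r\<close> the positive part in the area formula is inactive,
  so the square expands exactly and its linear term integrates to \<open>0\<close>. Farther out,
  damping the quadratic term by a factor \<open>k\<close> keeps the expansion below the
  integrand.\<close>

lemma measure_flower_growth:
  obtains r where "r > 0"
    "\<And>x. norm x \<le> r \<Longrightarrow> measure lborel (flower K 0 x) = measure lborel (flower K 0 0) + 2 * pi * (norm x)\<^sup>2"
    "\<And>x. norm x > r \<Longrightarrow> measure lborel (flower K 0 x) \<ge> measure lborel (flower K 0 0) + 2 * pi * (r * norm x)"
proof -
  let ?p = "support_fun K"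
  note cont = continuous_support_fun[OF K(1) K_nonempty]
  have "\<exists>t\<in>{0..2*pi}. \<forall>t'\<in>{0..2*pi}. ?p t \<le> ?p t'"
    by (intro continuous_attains_inf continuous_on_subset[OF cont]) auto
  then obtain r where r: "r > 0" "\<And>t. t \<in> {0..2*pi} \<Longrightarrow> r \<le> ?p t"
    using support_fun_pos by blast
  note V = measure_flower_eq[OF K(1) K_nonempty]
  have int: "((\<lambda>t. 2 * (max 0 (?p t - x \<bullet> unit_dir t))\<^sup>2) has_integral measure lborel (flower K 0 x)) {0..2*pi}" for x
    unfolding V
    by (intro integrable_integral integrable_continuous_interval continuous_intros
        continuous_on_subset[OF cont]) auto
  have abs_inner: "\<bar>x \<bullet> unit_dir t\<bar> \<le> norm x" for x t
    using Cauchy_Schwarz_ineq2[of x "unit_dir t"] by simp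
  have base: "((\<lambda>t. 2 * (?p t)\<^sup>2) has_integral measure lborel (flower K 0 0)) {0..2*pi}"
    using r by (intro has_integral_eq[OF _ int[of 0]]) (force simp: max_def)
  \<comment> \<open>\<open>k = 1\<close> will give the exact expansion near the origin, a smaller
    \<open>k\<close> the lower bound away from it.\<close>
  have quad: "((\<lambda>t. 2 * (?p t)\<^sup>2 - 4 * (?p t * (x \<bullet> unit_dir t)) + 2 * k * (x \<bullet> unit_dir t)\<^sup>2) has_integral
      measure lborel (flower K 0 0) + 2 * pi * (k * (norm x)\<^sup>2)) {0..2*pi}" for x k
  proof -
    have "((\<lambda>t. 2 * (?p t)\<^sup>2 - 4 * (?p t * (x \<bullet> unit_dir t)) + (2 * k) * (x \<bullet> unit_dir t)\<^sup>2) has_integral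
      measure lborel (flower K 0 0) - 4 * 0 + (2 * k) * (pi * (norm x)\<^sup>2)) {0..2*pi}"
      by (intro has_integral_add has_integral_diff base has_integral_mult_right
          integral_support_fun_inner integral_inner_unit_dir_square)
    then show ?thesis by (simp add: ac_simps)
  qed
  show thesis
  proof
    show "r > 0" by fact
    fix x :: "real^2"
    show "measure lborel (flower K 0 x) = measure lborel (flower K 0 0) + 2 * pi * (norm x)\<^sup>2" if "norm x \<le> r"
    proof (rule has_integral_unique[OF int])
      have "2 * (?p t)\<^sup>2 - 4 * (?p t * (x \<bullet> unit_dir t)) + 2 * 1 * (x \<bullet> unit_dir t)\<^sup>2 =
          2 * (max 0 (?p t - x \<bullet> unit_dir t))\<^sup>2" if "t \<in> {0..2*pi}" for t
      proof -
        have "x \<bullet> unit_dir t \<le> ?p t"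
          using r(2)[OF that] abs_inner[of x t] \<open>norm x \<le> r\<close> by linarith
        then show ?thesis
          by (simp add: max_def power2_eq_square algebra_simps)
      qed
      from has_integral_eq[OF this quad]
      show "((\<lambda>t. 2 * (max 0 (?p t - x \<bullet> unit_dir t))\<^sup>2) has_integral
          measure lborel (flower K 0 0) + 2 * pi * (norm x)\<^sup>2) {0..2*pi}" by simp
    qed
    show "measure lborel (flower K 0 x) \<ge> measure lborel (flower K 0 0) + 2 * pi * (r * norm x)" if "norm x > r"
    proof -
      \<comment> \<open>With this choice \<open>k * s \<le> r\<close> for every inner product
        \<open>s\<close> of \<open>x\<close> with a unit vector, and \<open>k\<close> times the
        squared norm becomes linear in \<open>norm x\<close>.\<close>
      define k where "k = r / norm x"
      have "norm x > 0" using that r(1) by linarith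
      have k: "0 < k" "k < 1" "k * norm x = r" using that r(1) \<open>norm x > 0\<close> by (simp_all add: k_def)
      have "2 * (?p t)\<^sup>2 - 4 * (?p t * (x \<bullet> unit_dir t)) + 2 * k * (x \<bullet> unit_dir t)\<^sup>2 \<le>
          2 * (max 0 (?p t - x \<bullet> unit_dir t))\<^sup>2" if "t \<in> {0..2*pi}" for t
      proof -
        define p s where "p = ?p t" and "s = x \<bullet> unit_dir t"
        have p: "r \<le> p" "\<bar>s\<bar> \<le> norm x" using r(2)[OF that] abs_inner[of x t] by (auto simp: p_def s_def)
        have "p\<^sup>2 - 2 * (p * s) + k * s\<^sup>2 \<le> (max 0 (p - s))\<^sup>2"
        proof (cases "s \<le> p")
          case True
          have "k * s\<^sup>2 \<le> s\<^sup>2" using k by (simp add: mult_left_le_one_le)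
          with True show ?thesis by (simp add: max_def power2_eq_square algebra_simps)
        next
          case False
          \<comment> \<open>Here the right side is \<open>0\<close>, and
            \<open>k * s \<le> r \<le> p < s\<close> bounds both square terms on the left by
            \<open>p * s\<close>.\<close>
          then have s: "s > p" "p > 0" using p r(1) by auto
          have "k * s \<le> r" using p(2) k by (metis abs_le_D1 less_imp_le mult_left_mono)
          then have "k * s * s \<le> p * s" using p s by (intro mult_right_mono) auto
          moreover have "p * p \<le> p * s" using s by (intro mult_left_mono) auto
          ultimately show ?thesis using False by (simp add: max_def power2_eq_square algebra_simps)
        qed
        then show ?thesis by (simp add: p_def s_def)
      qed
      from has_integral_le[OF quad int this]
      have "measure lborel (flower K 0 0) + 2 * pi * (k * (norm x)\<^sup>2) \<le> measure lborel (flower K 0 x)" .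
      moreover have "k * (norm x)\<^sup>2 = r * norm x"
        using k(3) by (simp add: power2_eq_square flip: mult.assoc)
      ultimately show ?thesis by simp
    qed
  qed
qed

end

section \<open>The Gaussian limit\<close>

lemma nn_integral_real2_prod:
  assumes [measurable]: "f \<in> borel_measurable borel" "g \<in> borel_measurable borel"
  shows "(\<integral>\<^sup>+z. f ((z :: real^2) $ 1) * g (z $ 2) \<partial>lborel) = (\<integral>\<^sup>+a. f a \<partial>lborel) * (\<integral>\<^sup>+b. g b \<partial>lborel)"
proof -
  have [measurable]: "(\<lambda>z :: real^2. z $ i) \<in> borel_measurable borel" for i
    by (intro borel_measurable_continuous_onI continuous_intros)
  have "(\<integral>\<^sup>+z. f ((z :: real^2) $ 1) * g (z $ 2) \<partial>lborel) = (\<integral>\<^sup>+a. \<integral>\<^sup>+b. f a * g b \<partial>lborel \<partial>lborel)"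
    by (subst nn_integral_real2) simp_all
  also have "\<dots> = (\<integral>\<^sup>+a. f a * (\<integral>\<^sup>+b. g b \<partial>lborel) \<partial>lborel)"
    by (simp add: nn_integral_cmult)
  also have "\<dots> = (\<integral>\<^sup>+a. f a \<partial>lborel) * (\<integral>\<^sup>+b. g b \<partial>lborel)"
    by (simp add: nn_integral_multc)
  finally show ?thesis .
qed

text \<open>Up to a factor \<open>1 / sqrt 2\<close> per coordinate, the integrand is a product of
  centred normal densities with variance \<open>1 / (4 * pi)\<close>.\<close>

lemma has_bochner_integral_gaussian_real2:
  "has_bochner_integral lborel (\<lambda>z :: real^2. exp (- (2 * pi * (norm z)\<^sup>2))) (1 / 2)"
proof (rule has_bochner_integral_nn_integral)
  let ?\<sigma> = "1 / (2 * sqrt pi)"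
  have dens: "exp (- (2 * pi * a\<^sup>2)) = 1 / sqrt 2 * normal_density 0 ?\<sigma> a" for a
    by (simp add: normal_density_def power_divide power_mult_distrib real_sqrt_divide)
  have 1: "(\<integral>\<^sup>+a. ennreal (normal_density 0 ?\<sigma> a) \<partial>lborel) = 1"
    by (subst nn_integral_eq_integral) auto
  have "(\<integral>\<^sup>+a. ennreal (exp (- (2 * pi * a\<^sup>2))) \<partial>lborel) = ennreal (1 / sqrt 2) * (\<integral>\<^sup>+a. ennreal (normal_density 0 ?\<sigma> a) \<partial>lborel)"
    unfolding dens by (subst nn_integral_cmult[symmetric]) (auto simp: ennreal_mult' simp del: times_divide_eq_left)
  then have gauss: "(\<integral>\<^sup>+a. ennreal (exp (- (2 * pi * a\<^sup>2))) \<partial>lborel) = ennreal (1 / sqrt 2)"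
    unfolding 1 by simp
  have "exp (- (2 * pi * (norm z)\<^sup>2)) = exp (- (2 * pi * (z $ 1)\<^sup>2)) * exp (- (2 * pi * (z $ 2)\<^sup>2))" for z :: "real^2"
    unfolding power2_norm_eq_inner
    by (simp add: inner_vec_def sum_2 power2_eq_square mult_exp_exp algebra_simps)
  then have "(\<integral>\<^sup>+z. ennreal (exp (- (2 * pi * (norm (z :: real^2))\<^sup>2))) \<partial>lborel) =
      (\<integral>\<^sup>+z. ennreal (exp (- (2 * pi * ((z :: real^2) $ 1)\<^sup>2))) * ennreal (exp (- (2 * pi * (z $ 2)\<^sup>2))) \<partial>lborel)"
    by (simp add: ennreal_mult)
  also have "\<dots> = ennreal (1 / sqrt 2) * ennreal (1 / sqrt 2)"
    by (subst nn_integral_real2_prod[where f="\<lambda>a. ennreal (exp (- (2 * pi * a\<^sup>2)))"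
          and g="\<lambda>a. ennreal (exp (- (2 * pi * a\<^sup>2)))"]) (simp_all add: gauss)
  also have "\<dots> = ennreal (1 / 2)"
    by (simp add: ennreal_mult[symmetric])
  finally show "(\<integral>\<^sup>+z. ennreal (exp (- (2 * pi * (norm (z :: real^2))\<^sup>2))) \<partial>lborel) = ennreal (1 / 2)" .
qed auto

text \<open>The integrand is at most \<open>1 / d\<close> times the sum of the exponential density
  and its mirror image.\<close>

lemma nn_integral_exp_abs_finite:
  assumes d: "d > 0"
  shows "(\<integral>\<^sup>+a. ennreal (exp (- (d * \<bar>a\<bar>))) \<partial>lborel) < \<infinity>"
proof -
  interpret E: prob_space "density lborel (exponential_density d)"
    by (rule prob_space_exponential_density[OF d])
  have 1: "(\<integral>\<^sup>+a. ennreal (exponential_density d a) \<partial>lborel) = 1"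
    using E.emeasure_space_1 by (simp add: emeasure_density)
  have 2: "(\<integral>\<^sup>+a. ennreal (exponential_density d (- a)) \<partial>lborel) = 1"
    using nn_integral_real_affine[of "\<lambda>a. ennreal (exponential_density d a)" "- 1" 0] 1 by simp
  have le: "ennreal (exp (- (d * \<bar>a\<bar>))) \<le>
      ennreal (1 / d) * (ennreal (exponential_density d a) + ennreal (exponential_density d (- a)))" for a
  proof -
    have "exp (- (d * \<bar>a\<bar>)) \<le> 1 / d * (exponential_density d a + exponential_density d (- a))"
      using d by (auto simp: exponential_density_def abs_if field_simps)
    then show ?thesis
      using d exponential_density_nonneg[OF d, of a] exponential_density_nonneg[OF d, of "- a"]
      by (subst ennreal_plus[symmetric], simp, simp, subst ennreal_mult[symmetric]) (auto intro: ennreal_leI)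
  qed
  have "(\<integral>\<^sup>+a. ennreal (exp (- (d * \<bar>a\<bar>))) \<partial>lborel) \<le>
      (\<integral>\<^sup>+a. ennreal (1 / d) * (ennreal (exponential_density d a) + ennreal (exponential_density d (- a))) \<partial>lborel)"
    by (intro nn_integral_mono le)
  also have "\<dots> = ennreal (1 / d) * (1 + 1)"
    by (subst nn_integral_cmult, simp, subst nn_integral_add) (simp_all add: 1 2)
  also have "\<dots> < \<infinity>"
    by (simp add: ennreal_mult_less_top)
  finally show ?thesis .
qed

text \<open>\<open>norm z\<close> is at least the mean of the two absolute coordinates, which gives
  a majorant of product form. The lemma serves to dominate the tails of the rescaled
  densities.\<close>

lemma integrable_exp_norm_real2:
  assumes c: "c > 0"
  shows "integrable lborel (\<lambda>z :: real^2. exp (- (c * norm z)))"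
proof (rule integrableI_bounded)
  let ?f = "\<lambda>a. ennreal (exp (- (c / 2 * \<bar>a\<bar>)))"
  have "ennreal (norm (exp (- (c * norm z)))) \<le> ?f (z $ 1) * ?f (z $ 2)" for z :: "real^2"
  proof -
    have "\<bar>z $ 1\<bar> \<le> norm z" "\<bar>z $ 2\<bar> \<le> norm z" by (rule component_le_norm_cart)+
    then have "c / 2 * (\<bar>z $ 1\<bar> + \<bar>z $ 2\<bar>) \<le> c / 2 * (2 * norm z)"
      using c by (intro mult_left_mono) auto
    then have "exp (- (c * norm z)) \<le> exp (- (c / 2 * \<bar>z $ 1\<bar>)) * exp (- (c / 2 * \<bar>z $ 2\<bar>))"
      by (simp add: mult_exp_exp algebra_simps)
    then show ?thesis by (simp add: ennreal_mult[symmetric] ennreal_leI)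
  qed
  then have "(\<integral>\<^sup>+z. ennreal (norm (exp (- (c * norm (z :: real^2))))) \<partial>lborel) \<le>
      (\<integral>\<^sup>+z. ?f ((z :: real^2) $ 1) * ?f (z $ 2) \<partial>lborel)"
    by (intro nn_integral_mono) auto
  also have "\<dots> = (\<integral>\<^sup>+a. ?f a \<partial>lborel) * (\<integral>\<^sup>+a. ?f a \<partial>lborel)"
    by (rule nn_integral_real2_prod) auto
  also have "\<dots> < \<infinity>"
    using nn_integral_exp_abs_finite[of "c / 2"] c by (simp add: ennreal_mult_less_top)
  finally show "(\<integral>\<^sup>+z. ennreal (norm (exp (- (c * norm (z :: real^2))))) \<partial>lborel) < \<infinity>" .
qed auto

lemma gaussian_measure_real2_scalar:
  "gaussian_measure 0 ((1 / (4 * pi)) *\<^sub>R mat 1 :: real^2^2) =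
    density lborel (\<lambda>x. ennreal (2 * exp (- (2 * pi * (norm x)\<^sup>2))))"
proof -
  have scale: "(a *\<^sub>R mat 1 :: real^2^2) ** (b *\<^sub>R mat 1) = (a * b) *\<^sub>R mat 1" for a b :: real
    by (simp add: vec_eq_iff forall_2 matrix_matrix_mult_def sum_2 mat_def)
  have inv: "matrix_inv ((1 / (4 * pi)) *\<^sub>R mat 1 :: real^2^2) = (4 * pi) *\<^sub>R mat 1"
  proof -
    \<comment> \<open>\<open>matrix_inv\<close> is defined by choice, so the chosen two-sided
      inverse is identified with \<open>D\<close> by uniqueness of inverses.\<close>
    define C D where "C = ((1 / (4 * pi)) *\<^sub>R mat 1 :: real^2^2)" and "D = ((4 * pi) *\<^sub>R mat 1 :: real^2^2)"
    have CD: "C ** D = mat 1" "D ** C = mat 1" by (simp_all add: C_def D_def scale)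
    then have "C ** matrix_inv C = mat 1 \<and> matrix_inv C ** C = mat 1"
      unfolding matrix_inv_def
      using someI[of "\<lambda>A. C ** A = mat 1 \<and> A ** C = mat 1" D] by blast
    then have inv: "C ** matrix_inv C = mat 1" by simp
    have "matrix_inv C = D ** C ** matrix_inv C" unfolding CD by (rule matrix_mul_lid[symmetric])
    also have "\<dots> = D ** (C ** matrix_inv C)" by (rule matrix_mul_assoc[symmetric])
    also have "\<dots> = D" unfolding inv by (rule matrix_mul_rid)
    finally show ?thesis unfolding C_def D_def .
  qed
  have vec: "((4 * pi) *\<^sub>R mat 1 :: real^2^2) *v x = (4 * pi) *\<^sub>R x" for x
    by (simp add: vec_eq_iff forall_2 matrix_vector_mult_def sum_2 mat_def)
  have det: "det ((1 / (4 * pi)) *\<^sub>R mat 1 :: real^2^2) = (1 / (4 * pi))\<^sup>2"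
    by (simp add: det_2 mat_def power2_eq_square)
  \<comment> \<open>In dimension two the root in the Gaussian density becomes \<open>1 / 2\<close>,
    whence the factor \<open>2\<close> in the simplified form.\<close>
  have "(2 * pi) * (1 / (4 * pi)) = 1 / 2" by simp
  then have "(2 * pi)\<^sup>2 * (1 / (4 * pi))\<^sup>2 = (1 / 2)\<^sup>2"
    unfolding power_mult_distrib[symmetric] by (rule arg_cong)
  moreover have "sqrt ((1 / 2)\<^sup>2) = 1 / 2"
    by (rule real_sqrt_unique) auto
  moreover have "CARD(2) = 2" by simp
  ultimately have sqrt: "sqrt ((2 * pi) ^ CARD(2) * det ((1 / (4 * pi)) *\<^sub>R mat 1 :: real^2^2)) = 1 / 2"
    unfolding det by (simp only:)
  have exponent: "- (x \<bullet> ((4 * pi) *\<^sub>R x)) / 2 = - (2 * pi * (norm x)\<^sup>2)" for x :: "real^2"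
    unfolding power2_norm_eq_inner inner_scaleR_right by linarith
  have "exp (- ((x - 0) \<bullet> (matrix_inv ((1 / (4 * pi)) *\<^sub>R mat 1) *v (x - 0))) / 2) /
      sqrt ((2 * pi) ^ CARD(2) * det ((1 / (4 * pi)) *\<^sub>R mat 1 :: real^2^2)) =
      2 * exp (- (2 * pi * (norm x)\<^sup>2))" for x :: "real^2"
    unfolding inv vec diff_0_right sqrt exponent by (rule trans[OF divide_divide_eq_right]) simp
  then show ?thesis
    unfolding gaussian_measure_def by (simp only:)
qed

lemma integral_lborel_scale:
  fixes h :: "'a::euclidean_space \<Rightarrow> real"
  assumes [measurable]: "h \<in> borel_measurable borel" and c: "c > 0"
  shows "(\<integral>x. h x \<partial>lborel) = c ^ DIM('a) * (\<integral>z. h (c *\<^sub>R z) \<partial>lborel)"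
proof -
  have "(\<integral>x. h x \<partial>lborel) =
      (\<integral>x. h x \<partial>density (distr lborel borel (\<lambda>x. 0 + c *\<^sub>R x)) (\<lambda>_. ennreal (c ^ DIM('a))))"
    using lborel_affine[of c "0 :: 'a"] c by simp
  also have "\<dots> = (\<integral>z. c ^ DIM('a) * h (c *\<^sub>R z) \<partial>lborel)"
    using c by (subst integral_density) (auto simp: integral_distr)
  finally show ?thesis by simp
qed

theorem proposition5p1:
  fixes K :: "(real^2) set"
    and M :: "real \<Rightarrow> 'w measure"
    and P :: "real \<Rightarrow> 'w \<Rightarrow> (real^2) set"
    and S :: "real \<Rightarrow> 'w set"
    and Z :: "real \<Rightarrow> 'w \<Rightarrow> real^2"
  assumes "convex_body K"
    and "steiner_point K = 0"
    and "\<And>l. l > 0 \<Longrightarrow> homogeneous_poisson_process (M l) (P l) l"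
    and "\<And>l. l > 0 \<Longrightarrow> S l = cell_contains_event (M l) (P l) K"
    and "\<And>l \<omega>. l > 0 \<Longrightarrow> \<omega> \<in> S l \<Longrightarrow> Z l \<omega> = nucleus_containing (P l \<omega>) K"
  shows "(\<forall>l>0. S l \<in> sets (M l) \<and> measure (M l) (S l) > 0 \<and>
                Z l \<in> borel_measurable (restrict_space (M l) (S l))) \<and>
         converges_weakly
           (\<lambda>l. conditional_law (M l) (S l) (\<lambda>\<omega>. sqrt l *\<^sub>R Z l \<omega>))
           (gaussian_measure 0 ((1 / (4 * pi)) *\<^sub>R mat 1)) at_top"
proof
  have K: "compact K" "interior K \<noteq> {}"
    using assms(1) by (auto simp: convex_body_def)
  have pp: "poisson_process (M l) (P l) l" if "l > 0" for l
    using assms(3)[OF that] that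
    by (auto simp: poisson_process_def poisson_process_axioms_def homogeneous_poisson_process_def)
  have Z: "\<forall>\<omega>\<in>cell_contains_event (M l) (P l) K. Z l \<omega> = nucleus_containing (P l \<omega>) K" if "l > 0" for l
    using assms(4,5) that by simp
  show "\<forall>l>0. S l \<in> sets (M l) \<and> measure (M l) (S l) > 0 \<and>
      Z l \<in> borel_measurable (restrict_space (M l) (S l))"
  proof (intro allI impI conjI)
    fix l :: real assume l: "l > 0"
    note facts = pp[OF l] K Z[OF l]
    show "S l \<in> sets (M l)"
      unfolding assms(4)[OF l] by (rule poisson_process.cell_contains_event_measurable[OF facts])
    show "measure (M l) (S l) > 0"
      unfolding assms(4)[OF l] by (rule poisson_process.prob_cell_contains_event_pos[OF facts])
    show "Z l \<in> borel_measurable (restrict_space (M l) (S l))"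
      unfolding assms(4)[OF l] by (rule poisson_process.nucleus_measurable[OF facts])
  qed
  define V where "V = (\<lambda>x. measure lborel (flower K 0 x))"
  have V [measurable]: "V \<in> borel_measurable borel"
    unfolding V_def by (rule measure_flower_measurable[OF K(1)])
  obtain r where r: "r > 0"
    "\<And>x. norm x \<le> r \<Longrightarrow> V x = V 0 + 2 * pi * (norm x)\<^sup>2"
    "\<And>x. norm x > r \<Longrightarrow> V x \<ge> V 0 + 2 * pi * (r * norm x)"
    using measure_flower_growth[OF K assms(2)] unfolding V_def by blast
  \<comment> \<open>The density of the rescaled nucleus up to factors independent of
    \<open>z\<close>. Subtracting \<open>V 0\<close> splits off \<open>exp (- (l * V 0))\<close>,
    which will cancel on normalisation.\<close>
  define G where "G = (\<lambda>l z. exp (- (l * (V ((1 / sqrt l) *\<^sub>R z) - V 0))))"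
  define \<gamma> where "\<gamma> = (\<lambda>z :: real^2. exp (- (2 * pi * (norm z)\<^sup>2)))"
  have gaussian_eq: "gaussian_measure 0 ((1 / (4 * pi)) *\<^sub>R mat 1) = density lborel (\<lambda>z. ennreal (2 * \<gamma> z))"
    unfolding \<gamma>_def by (rule gaussian_measure_real2_scalar)
  note \<gamma>_int = has_bochner_integral_gaussian_real2[folded \<gamma>_def]
  have [measurable]: "G l \<in> borel_measurable borel" "\<gamma> \<in> borel_measurable borel" for l
    unfolding G_def \<gamma>_def by measurable
  \<comment> \<open>Substituting \<open>x = z / sqrt l\<close> in the plane produces the factor
    \<open>1 / l\<close>, which cancels the intensity.\<close>
  have scale: "(\<integral>x. l * exp (- (l * V x)) * f (sqrt l *\<^sub>R x) \<partial>lborel) =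
      exp (- (l * V 0)) * (\<integral>z. G l z * f z \<partial>lborel)"
    if l: "l > 0" and [measurable]: "f \<in> borel_measurable borel" for l and f :: "real^2 \<Rightarrow> real"
  proof -
    have "(\<integral>x. l * exp (- (l * V x)) * f (sqrt l *\<^sub>R x) \<partial>lborel) = (1 / sqrt l) ^ DIM(real^2) *
        (\<integral>z. l * exp (- (l * V ((1 / sqrt l) *\<^sub>R z))) * f (sqrt l *\<^sub>R (1 / sqrt l) *\<^sub>R z) \<partial>lborel)"
      using l by (intro integral_lborel_scale) auto
    also have "(1 / sqrt l) ^ DIM(real^2) = 1 / l"
      using l by (simp add: power_divide)
    also have "(\<integral>z. l * exp (- (l * V ((1 / sqrt l) *\<^sub>R z))) * f (sqrt l *\<^sub>R (1 / sqrt l) *\<^sub>R z) \<partial>lborel) =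
        (\<integral>z. (l * exp (- (l * V 0))) * (G l z * f z) \<partial>lborel)"
    proof (rule Bochner_Integration.integral_cong[OF refl])
      fix z :: "real^2"
      have "exp (- (l * V ((1 / sqrt l) *\<^sub>R z))) = exp (- (l * V 0)) * G l z"
        unfolding G_def exp_add[symmetric] by (simp add: right_diff_distrib)
      moreover have "sqrt l *\<^sub>R (1 / sqrt l) *\<^sub>R z = z"
        using l by simp
      ultimately show "l * exp (- (l * V ((1 / sqrt l) *\<^sub>R z))) * f (sqrt l *\<^sub>R (1 / sqrt l) *\<^sub>R z) =
          l * exp (- (l * V 0)) * (G l z * f z)"
        by (simp only: mult.assoc)
    qed
    finally show ?thesis using l by simp
  qed
  have limit: "((\<lambda>l. \<integral>z. G l z * f z \<partial>lborel) \<longlongrightarrow> (\<integral>z. \<gamma> z * f z \<partial>lborel)) at_top"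
    if [measurable]: "f \<in> borel_measurable borel" and B: "\<And>z. \<bar>f z\<bar> \<le> B" for f :: "real^2 \<Rightarrow> real" and B
  proof -
    \<comment> \<open>The first summand dominates where \<open>norm z \<le> r * sqrt l\<close>, the
      second elsewhere; \<open>B\<close> accounts for the test function.\<close>
    define w where "w = (\<lambda>z :: real^2. (\<gamma> z + exp (- (2 * pi * r * norm z))) * B)"
    have lim: "((\<lambda>l. G l z * f z) \<longlongrightarrow> \<gamma> z * f z) at_top" for z
    \<comment> \<open>As soon as \<open>z / sqrt l\<close> lies in the ball of radius
      \<open>r\<close>, where the area is exactly quadratic, the limit value is attained. The
      \<open>1\<close> in the threshold ensures \<open>l > 0\<close>.\<close>
    proof (rule tendsto_eventually)
      have "\<forall>\<^sub>F l in at_top. l \<ge> max 1 ((norm z / r)\<^sup>2)"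
        by (rule eventually_ge_at_top)
      then show "\<forall>\<^sub>F l in at_top. G l z * f z = \<gamma> z * f z"
      proof eventually_elim
        case (elim l)
        then have l: "l > 0" "(norm z / r)\<^sup>2 \<le> l" by auto
        then have "norm z / r \<le> sqrt l"
          by (simp add: real_le_rsqrt)
        then have "norm z \<le> r * sqrt l"
          using r(1) by (simp add: pos_divide_le_eq mult.commute)
        then have "norm ((1 / sqrt l) *\<^sub>R z) \<le> r"
          using l(1) by (simp add: pos_divide_le_eq)
        from r(2)[OF this] have "l * (V ((1 / sqrt l) *\<^sub>R z) - V 0) = 2 * pi * (norm z)\<^sup>2"
          using l by (simp add: power_divide)
        then show ?case unfolding G_def \<gamma>_def by simp
      qed
    qed
    have bound: "norm (G l z * f z) \<le> w z" if l: "l \<ge> 1" for l z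
    proof -
      have "G l z \<le> \<gamma> z + exp (- (2 * pi * r * norm z))"
      proof (cases "norm ((1 / sqrt l) *\<^sub>R z) \<le> r")
        case True
        from r(2)[OF this] have "l * (V ((1 / sqrt l) *\<^sub>R z) - V 0) = 2 * pi * (norm z)\<^sup>2"
          using l by (simp add: power_divide)
        then show ?thesis unfolding G_def \<gamma>_def by simp
      next
        case False
        then have "2 * pi * (r * norm ((1 / sqrt l) *\<^sub>R z)) \<le> V ((1 / sqrt l) *\<^sub>R z) - V 0"
          using r(3)[of "(1 / sqrt l) *\<^sub>R z"] by linarith
        then have "l * (2 * pi * (r * norm ((1 / sqrt l) *\<^sub>R z))) \<le> l * (V ((1 / sqrt l) *\<^sub>R z) - V 0)"
          using l by (intro mult_left_mono) auto
        moreover have "l * (2 * pi * (r * norm ((1 / sqrt l) *\<^sub>R z))) = sqrt l * (2 * pi * r * norm z)"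
        proof -
          define q where "q = sqrt l"
          have "q > 0" "l = q * q" using l by (simp_all add: q_def)
          then show ?thesis unfolding q_def[symmetric] by simp
        qed
        \<comment> \<open>\<open>l \<ge> 1\<close> enters here and makes the bound independent of
          \<open>l\<close>.\<close>
        moreover have "1 * (2 * pi * r * norm z) \<le> sqrt l * (2 * pi * r * norm z)"
          using l r(1) by (intro mult_right_mono) auto
        ultimately have "G l z \<le> exp (- (2 * pi * r * norm z))"
          unfolding G_def exp_le_cancel_iff by linarith
        moreover have "\<gamma> z \<ge> 0" by (simp add: \<gamma>_def)
        ultimately show ?thesis by linarith
      qed
      then have "G l z * \<bar>f z\<bar> \<le> w z"
        unfolding w_def using B[of z] by (intro mult_mono) (auto simp: \<gamma>_def)
      then show ?thesis by (simp add: abs_mult G_def)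
    qed
    show ?thesis
    proof (rule integral_dominated_convergence_at_top)
      show "integrable lborel w"
        unfolding w_def using \<gamma>_int r(1) integrable_exp_norm_real2[of "2 * pi * r"]
        by (auto simp: has_bochner_integral_iff)
      show "\<forall>\<^sub>F l in at_top. AE z in lborel. norm (G l z * f z) \<le> w z"
        using eventually_ge_at_top[of 1] by eventually_elim (use bound in auto)
      show "AE z in lborel. ((\<lambda>l. G l z * f z) \<longlongrightarrow> \<gamma> z * f z) at_top"
        using lim by simp
    qed auto
  qed
  show "converges_weakly (\<lambda>l. conditional_law (M l) (S l) (\<lambda>\<omega>. sqrt l *\<^sub>R Z l \<omega>))
      (gaussian_measure 0 ((1 / (4 * pi)) *\<^sub>R mat 1)) at_top"
    unfolding converges_weakly_def gaussian_eq
  proof (intro allI impI)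
    fix f :: "real^2 \<Rightarrow> real"
    assume f: "continuous_on UNIV f" "bounded (range f)"
    then have [measurable]: "f \<in> borel_measurable borel"
      by (intro borel_measurable_continuous_onI)
    obtain B where B: "\<And>z. \<bar>f z\<bar> \<le> B"
      using f(2) by (auto simp: bounded_iff)
    \<comment> \<open>Numerator and denominator share the factor \<open>exp (- (l * V 0))\<close>,
      so only integrals against \<open>G l\<close> remain.\<close>
    have ratio: "integral\<^sup>L (conditional_law (M l) (S l) (\<lambda>\<omega>. sqrt l *\<^sub>R Z l \<omega>)) f =
        (\<integral>z. G l z * f z \<partial>lborel) / (\<integral>z. G l z * 1 \<partial>lborel)" if l: "l > 0" for l
    proof -
      have "integral\<^sup>L (conditional_law (M l) (S l) (\<lambda>\<omega>. sqrt l *\<^sub>R Z l \<omega>)) f =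
          (\<integral>x. l * exp (- (l * V x)) * f (sqrt l *\<^sub>R x) \<partial>lborel) /
          (\<integral>x. l * exp (- (l * V x)) * 1 \<partial>lborel)"
        using poisson_process.integral_conditional_law[OF pp[OF l] K Z[OF l], of f]
          poisson_process.prob_cell_contains_event_eq[OF pp[OF l] K Z[OF l]] assms(4)[OF l]
        by (simp add: V_def)
      then show ?thesis
        unfolding scale[OF l \<open>f \<in> _\<close>] scale[OF l, of "\<lambda>_. 1", OF borel_measurable_const] by simp
    qed
    have "((\<lambda>l. (\<integral>z. G l z * f z \<partial>lborel) / (\<integral>z. G l z * 1 \<partial>lborel)) \<longlongrightarrow>
        (\<integral>z. \<gamma> z * f z \<partial>lborel) / (\<integral>z. \<gamma> z * 1 \<partial>lborel)) at_top"
      using \<gamma>_int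
      by (intro tendsto_divide limit[OF _ B] limit[of "\<lambda>_. 1" 1]) (auto simp: has_bochner_integral_iff)
    \<comment> \<open>The integral of \<open>\<gamma>\<close> is \<open>1 / 2\<close>, so dividing
      by it amounts to the factor \<open>2\<close> of the Gaussian density.\<close>
    also have "(\<integral>z. \<gamma> z * f z \<partial>lborel) / (\<integral>z. \<gamma> z * 1 \<partial>lborel) =
        (\<integral>z. f z \<partial>density lborel (\<lambda>x. ennreal (2 * \<gamma> x)))"
    proof -
      have "(\<integral>z. f z \<partial>density lborel (\<lambda>x. ennreal (2 * \<gamma> x))) = (\<integral>z. (2 * \<gamma> z) *\<^sub>R f z \<partial>lborel)"
        by (rule integral_density) (auto simp: \<gamma>_def)
      also have "\<dots> = 2 * (\<integral>z. \<gamma> z * f z \<partial>lborel)"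
        by (simp add: mult.assoc)
      finally show ?thesis
        unfolding mult_1_right has_bochner_integral_integral_eq[OF \<gamma>_int] by simp
    qed
    finally show "((\<lambda>l. integral\<^sup>L (conditional_law (M l) (S l) (\<lambda>\<omega>. sqrt l *\<^sub>R Z l \<omega>)) f) \<longlongrightarrow>
        (\<integral>z. f z \<partial>density lborel (\<lambda>x. ennreal (2 * \<gamma> x)))) at_top"
    proof (rule Lim_transform_eventually)
      show "\<forall>\<^sub>F l in at_top. (\<integral>z. G l z * f z \<partial>lborel) / (\<integral>z. G l z * 1 \<partial>lborel) =
          integral\<^sup>L (conditional_law (M l) (S l) (\<lambda>\<omega>. sqrt l *\<^sub>R Z l \<omega>)) f"
        using eventually_gt_at_top[of 0] by eventually_elim (rule ratio[symmetric])
    qed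
  qed
qed

end
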